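(* Let $G$ be a finite connected graph with nonempty $2$-core $K:=\mathrm{core}_2(G)\neq\varnothing$. Then $$\mathrm{DN}_{\mathrm{LLY}}(G)<\infty\quad\Longleftrightarrow\quad \mathrm{DN}_{\mathrm{LLY}}(\widehat K_G)<\infty .$$
   Context: Graphs are simple and undirected. Let $d(\cdot,\cdot)$ be the combinatorial graph distance. For a positive edge weight $w:E\to(0,\infty)$ put $d_x^w:=\sum_{y\sim x}w_{xy}$. For $\alpha\in[0,1]$ let $\mu_x^{\alpha,w}$ be the probability measure with $\mu_x^{\alpha,w}(x)=\alpha$, $\mu_x^{\alpha,w}(z)=(1-\alpha)w_{xz}/d_x^w$ for $z\sim x$, and $0$ otherwise. Let $W_1$ be the $1$-Wasserstein distance with respect to $d$. For $x\sim y$ let $\kappa_\alpha^w(x,y):=1-W_1(\mu_x^{\alpha,w},\mu_y^{\alpha,w})$ and define the weighted Lin--Lu--Yau curvature $\kappa_{\mathrm{LLY}}^w(x,y):=\lim_{\alpha\to1^-}\kappa_\alpha^w(x,y)/(1-\alpha)$. For connected locally finite $G$ with $E\neq\varnothing$: $\mathrm{Dist}(w):=\sup_{e\in E}w_e/\inf_{e\in E}w_e$, with value $+\infty$ if the supremum is infinite or the infimum is $0$; a positive weight $w$ is admissible if $\kappa_{\mathrm{LLY}}^w(e)\ge0$ for every $e\in E$; and $\mathrm{DN}_{\mathrm{LLY}}(G):=\inf\{\mathrm{Dist}(w): w \text{ admissible}\}$, with value $+\infty$ if no admissible weight has finite distortion. By convention $\mathrm{DN}_{\mathrm{LLY}}(K_1)=1$.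 The $2$-core $\mathrm{core}_2(G)$ of a finite graph $G$ is the unique maximal subgraph of minimum degree at least $2$ (equivalently, what remains after repeatedly deleting vertices of degree $0$ or $1$). With $K=\mathrm{core}_2(G)$, let $A_G:=\{x\in V(K): x \text{ has a neighbor (in } G)\text{ in } V(G)\setminus V(K)\}$. The graph $\widehat K_G$ is obtained from $K$ by attaching exactly one new pendant vertex $x^\partial$ to each $x\in A_G$ (via the edge $xx^\partial$). *)

theory Defs
  imports "HOL-Probability.Probability"
begin

section \<open>Simple undirected graphs\<close>

record 'a ugraph =
  verts :: "'a set"
  edges :: "'a set set"

definition simple_graph :: "'a ugraph \<Rightarrow> bool" where
  "simple_graph G \<longleftrightarrow>
     (\<forall>e\<in>edges G. \<exists>x y. x \<in> verts G \<and> y \<in> verts G \<and> x \<noteq> y \<and> e = {x, y})"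

definition adj :: "'a ugraph \<Rightarrow> 'a \<Rightarrow> 'a \<Rightarrow> bool" where
  "adj G x y \<longleftrightarrow> {x, y} \<in> edges G"

definition nbrs :: "'a ugraph \<Rightarrow> 'a \<Rightarrow> 'a set" where
  "nbrs G x = {y. adj G x y}"

definition connected_graph :: "'a ugraph \<Rightarrow> bool" where
  "connected_graph G \<longleftrightarrow>
     verts G \<noteq> {} \<and> (\<forall>x\<in>verts G. \<forall>y\<in>verts G. (adj G)\<^sup>*\<^sup>* x y)"

text \<open>Length of a shortest walk; only meaningful within a connected component.\<close>

definition gdist :: "'a ugraph \<Rightarrow> 'a \<Rightarrow> 'a \<Rightarrow> nat" where
  "gdist G x y = (LEAST n. (adj G ^^ n) x y)"


section \<open>Weighted Lin--Lu--Yau curvature\<close>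

definition positive_weight :: "'a ugraph \<Rightarrow> ('a set \<Rightarrow> real) \<Rightarrow> bool" where
  "positive_weight G w \<longleftrightarrow> (\<forall>e\<in>edges G. 0 < w e)"

definition wdeg :: "'a ugraph \<Rightarrow> ('a set \<Rightarrow> real) \<Rightarrow> 'a \<Rightarrow> real" where
  "wdeg G w x = (\<Sum>y\<in>nbrs G x. w {x, y})"

definition lazy_walk :: "'a ugraph \<Rightarrow> ('a set \<Rightarrow> real) \<Rightarrow> real \<Rightarrow> 'a \<Rightarrow> 'a pmf" where
  "lazy_walk G w \<alpha> x = embed_pmf (\<lambda>z.
     if z = x then \<alpha>
     else if adj G x z then (1 - \<alpha>) * w {x, z} / wdeg G w x
     else 0)"

text \<open>The function embedded above is indeed a probability mass function as soon as
  \<open>x\<close> is not isolated, which is the only case in which curvature refers to it.\<close>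

lemma pmf_lazy_walk:
  assumes "simple_graph G" "finite (nbrs G x)" "nbrs G x \<noteq> {}"
    and "positive_weight G w" "0 \<le> \<alpha>" "\<alpha> \<le> 1"
  shows "pmf (lazy_walk G w \<alpha> x) z =
     (if z = x then \<alpha>
      else if adj G x z then (1 - \<alpha>) * w {x, z} / wdeg G w x
      else 0)"
proof -
  let ?f = "\<lambda>z. if z = x then \<alpha>
      else if adj G x z then (1 - \<alpha>) * w {x, z} / wdeg G w x else 0"
  have w_pos: "0 < w {x, y}" if "y \<in> nbrs G x" for y
    using that assms(4) by (auto simp: nbrs_def adj_def positive_weight_def)
  have x_notin: "x \<notin> nbrs G x"
    using assms(1) by (fastforce simp: nbrs_def adj_def simple_graph_def doubleton_eq_iff)
  have deg_pos: "0 < wdeg G w x"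
    unfolding wdeg_def by (rule sum_pos) (use assms w_pos in auto)
  have nonneg: "0 \<le> ?f z" for z
    using w_pos[of z] deg_pos assms(5,6) by (auto simp: nbrs_def)
  have "(\<Sum>z\<in>nbrs G x. ?f z) = (\<Sum>z\<in>nbrs G x. (1 - \<alpha>) * w {x, z} / wdeg G w x)"
    by (rule sum.cong) (use x_notin in \<open>auto simp: nbrs_def\<close>)
  also have "\<dots> = 1 - \<alpha>"
    using deg_pos by (simp add: wdeg_def flip: sum_divide_distrib sum_distrib_left)
  finally have total: "(\<Sum>z\<in>insert x (nbrs G x). ?f z) = 1"
    using assms(2) x_notin by simp
  have "(\<integral>\<^sup>+z. ennreal (?f z) \<partial>count_space UNIV)
      = (\<Sum>z\<in>insert x (nbrs G x). ennreal (?f z))"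
    by (rule nn_integral_count_space') (use assms(2) in \<open>auto simp: nbrs_def\<close>)
  also have "\<dots> = ennreal (\<Sum>z\<in>insert x (nbrs G x). ?f z)"
    by (rule sum_ennreal) (rule nonneg)
  finally have "(\<integral>\<^sup>+z. ennreal (?f z) \<partial>count_space UNIV) = 1"
    by (simp only: total ennreal_1)
  then show ?thesis
    unfolding lazy_walk_def by (subst pmf_embed_pmf) (use nonneg in auto)
qed

definition couplings :: "'a pmf \<Rightarrow> 'a pmf \<Rightarrow> ('a \<times> 'a) pmf set" where
  "couplings \<mu> \<nu> = {\<pi>. map_pmf fst \<pi> = \<mu> \<and> map_pmf snd \<pi> = \<nu>}"

text \<open>The expectation is a Bochner integral, so this is the Wasserstein distance for
  finitely supported \<open>\<mu>\<close> and \<open>\<nu>\<close>, where every cost is integrable.\<close>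

definition wasserstein1 :: "('a \<Rightarrow> 'a \<Rightarrow> real) \<Rightarrow> 'a pmf \<Rightarrow> 'a pmf \<Rightarrow> real" where
  "wasserstein1 d \<mu> \<nu> =
     (INF \<pi>\<in>couplings \<mu> \<nu>. measure_pmf.expectation \<pi> (\<lambda>(x, y). d x y))"

definition kappa :: "'a ugraph \<Rightarrow> ('a set \<Rightarrow> real) \<Rightarrow> real \<Rightarrow> 'a \<Rightarrow> 'a \<Rightarrow> real" where
  "kappa G w \<alpha> x y =
     1 - wasserstein1 (\<lambda>u v. real (gdist G u v)) (lazy_walk G w \<alpha> x) (lazy_walk G w \<alpha> y)"

definition kappa_LLY :: "'a ugraph \<Rightarrow> ('a set \<Rightarrow> real) \<Rightarrow> 'a \<Rightarrow> 'a \<Rightarrow> real" where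
  "kappa_LLY G w x y = Lim (at_left 1) (\<lambda>\<alpha>. kappa G w \<alpha> x y / (1 - \<alpha>))"


section \<open>Distortion number\<close>

definition distortion :: "'a ugraph \<Rightarrow> ('a set \<Rightarrow> real) \<Rightarrow> ereal" where
  "distortion G w =
     (let S = (SUP e\<in>edges G. ereal (w e)); I = (INF e\<in>edges G. ereal (w e))
      in if S = \<infinity> \<or> I = 0 then \<infinity> else S / I)"

definition admissible :: "'a ugraph \<Rightarrow> ('a set \<Rightarrow> real) \<Rightarrow> bool" where
  "admissible G w \<longleftrightarrow>
     positive_weight G w \<and> (\<forall>x y. adj G x y \<longrightarrow> 0 \<le> kappa_LLY G w x y)"

text \<open>The infimum is taken in the extended reals, where the empty set has infimum \<open>\<infinity>\<close>.\<close>

definition DN_LLY :: "'a ugraph \<Rightarrow> ereal" where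
  "DN_LLY G =
     (if \<exists>x. verts G = {x} then 1 else (INF w\<in>{w. admissible G w}. distortion G w))"


section \<open>The 2-core and its pendant augmentation\<close>

definition subgraph :: "'a ugraph \<Rightarrow> 'a ugraph \<Rightarrow> bool" where
  "subgraph H G \<longleftrightarrow> simple_graph H \<and> verts H \<subseteq> verts G \<and> edges H \<subseteq> edges G"

text \<open>The empty graph satisfies this condition vacuously, so a 2-core always exists but
  may be empty.\<close>

definition min_degree_ge2 :: "'a ugraph \<Rightarrow> bool" where
  "min_degree_ge2 H \<longleftrightarrow> (\<forall>x\<in>verts H. 2 \<le> card (nbrs H x))"

definition is_core2 :: "'a ugraph \<Rightarrow> 'a ugraph \<Rightarrow> bool" where
  "is_core2 G K \<longleftrightarrow> subgraph K G \<and> min_degree_ge2 K \<and>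
     (\<forall>H. subgraph H G \<and> min_degree_ge2 H \<and> subgraph K H \<longrightarrow> H = K)"

definition core2 :: "'a ugraph \<Rightarrow> 'a ugraph" where
  "core2 G = (THE K. is_core2 G K)"

lemma finite_nbrs:
  assumes "simple_graph G" "finite (verts G)"
  shows "finite (nbrs G x)"
proof (rule finite_subset[OF _ assms(2)])
  show "nbrs G x \<subseteq> verts G"
    using assms(1) by (fastforce simp: nbrs_def adj_def simple_graph_def doubleton_eq_iff)
qed

lemma ex1_is_core2:
  fixes G :: "'a ugraph"
  assumes G: "simple_graph G" "finite (verts G)"
  shows "\<exists>!K. is_core2 G K"
proof -
  let ?\<H> = "{H. subgraph H G \<and> min_degree_ge2 H}"
  define U :: "'a ugraph" where
    "U = \<lparr>verts = (\<Union>H\<in>?\<H>. verts H), edges = (\<Union>H\<in>?\<H>. edges H)\<rparr>"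
  have simple_U: "simple_graph U"
    unfolding simple_graph_def
  proof
    fix e assume "e \<in> edges U"
    then obtain H where H: "H \<in> ?\<H>" "e \<in> edges H" by (auto simp: U_def)
    then obtain x y where "x \<in> verts H" "y \<in> verts H" "x \<noteq> y" "e = {x, y}"
      by (auto simp: subgraph_def simple_graph_def)
    with H show "\<exists>x y. x \<in> verts U \<and> y \<in> verts U \<and> x \<noteq> y \<and> e = {x, y}"
      by (auto simp: U_def)
  qed
  have sub_G: "subgraph U G"
    using simple_U unfolding subgraph_def by (auto simp: U_def subgraph_def)
  have sub_U: "subgraph H U" if "H \<in> ?\<H>" for H
    using that unfolding subgraph_def by (auto simp: U_def subgraph_def)
  have "finite (verts U)"
    using sub_G G(2) by (auto simp: subgraph_def intro: finite_subset)
  then have fin_U: "finite (nbrs U x)" for x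
    by (rule finite_nbrs[OF simple_U])
  have deg_U: "min_degree_ge2 U"
    unfolding min_degree_ge2_def
  proof
    fix x assume "x \<in> verts U"
    then obtain H where H: "H \<in> ?\<H>" "x \<in> verts H" by (auto simp: U_def)
    then have "2 \<le> card (nbrs H x)" by (auto simp: min_degree_ge2_def)
    also have "\<dots> \<le> card (nbrs U x)"
      by (rule card_mono[OF fin_U]) (use H in \<open>auto simp: nbrs_def adj_def U_def\<close>)
    finally show "2 \<le> card (nbrs U x)" .
  qed
  have antisym: "H = K" if "subgraph H K" "subgraph K H" for H K :: "'a ugraph"
    using that by (intro ugraph.equality) (auto simp: subgraph_def)
  show ?thesis
  proof
    show "is_core2 G U"
      using sub_G deg_U sub_U antisym unfolding is_core2_def by blast
  next
    fix K assume "is_core2 G K"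
    then show "K = U"
      using sub_G deg_U sub_U[of K] unfolding is_core2_def by blast
  qed
qed

definition attach_set :: "'a ugraph \<Rightarrow> 'a set" where
  "attach_set G =
     {x \<in> verts (core2 G). \<exists>y \<in> verts G - verts (core2 G). adj G x y}"

text \<open>\<open>Inl x\<close> is the core vertex \<open>x\<close>, and \<open>Inr x\<close> is the new pendant vertex attached to it.\<close>

definition pendant_core :: "'a ugraph \<Rightarrow> ('a + 'a) ugraph" where
  "pendant_core G =
     \<lparr>verts = Inl ` verts (core2 G) \<union> Inr ` attach_set G,
      edges = (\<lambda>e. Inl ` e) ` edges (core2 G) \<union> (\<lambda>x. {Inl x, Inr x}) ` attach_set G\<rparr>"

end

theory Submission
  imports Defs
begin

text \<open>For a finite graph with an edge, finiteness of the distortion number just means that an admissible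
  weight exists. \<open>G\<close> arises from its 2-core by attaching trees, and collapsing the tree vertices
  hanging off a core vertex \<open>x\<close> to the pendant vertex of \<open>x\<close> preserves the distance between
  any neighbour of \<open>x\<close> and any neighbour of \<open>y\<close> for each core edge \<open>xy\<close>. So if the pendant edge
  at \<open>x\<close> carries the total weight of the tree edges at \<open>x\<close>, the curvatures of all core edges agree in the two
  graphs. All other edges are bridges, and a bridge \<open>xy\<close> has curvature
  \<open>2 (w\<^sub>x\<^sub>y / d\<^sub>x + w\<^sub>x\<^sub>y / d\<^sub>y) - 2\<close>: this is nonnegative at a pendant vertex, and it can be made nonnegative on
  the trees by letting the weights decay fast enough away from the core.\<close>

section \<open>Transport between finitely supported measures\<close>

text \<open>Couplings of the image measures are exactly the images of couplings, at equal cost.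
  Points are compared only across the two supports, so \<open>\<phi>\<close> may distort distances
  within either one.\<close>

lemma wasserstein1_map_pmf:
  fixes \<phi> :: "'a \<Rightarrow> 'b"
  assumes d: "\<And>u v. u \<in> set_pmf \<mu> \<Longrightarrow> v \<in> set_pmf \<nu> \<Longrightarrow> d' (\<phi> u) (\<phi> v) = d u v"
  shows "wasserstein1 d' (map_pmf \<phi> \<mu>) (map_pmf \<phi> \<nu>) = wasserstein1 d \<mu> \<nu>"
proof -
  have E: "measure_pmf.expectation (map_pmf (map_prod \<phi> \<phi>) \<pi>) (\<lambda>(x, y). d' x y)
      = measure_pmf.expectation \<pi> (\<lambda>(x, y). d x y)" if "\<pi> \<in> couplings \<mu> \<nu>" for \<pi>
  proof -
    have "fst z \<in> set_pmf \<mu> \<and> snd z \<in> set_pmf \<nu>" if "z \<in> set_pmf \<pi>" for z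
      using \<open>\<pi> \<in> _\<close> that by (auto simp: couplings_def)
    then show ?thesis
      unfolding integral_map_pmf
      by (intro integral_cong_AE AE_pmfI) (auto simp: d split: prod.splits)
  qed
  have push: "map_pmf (map_prod \<phi> \<phi>) \<pi> \<in> couplings (map_pmf \<phi> \<mu>) (map_pmf \<phi> \<nu>)"
    if "\<pi> \<in> couplings \<mu> \<nu>" for \<pi>
    using that by (auto simp: couplings_def pmf.map_comp comp_def)
  \<comment> \<open>Gluing twice: \<open>\<rho>\<close> couples \<open>\<mu>\<close> with
    \<open>\<pi>'\<close> over the first coordinate, then \<open>\<sigma>\<close> couples
    \<open>\<rho>\<close> with \<open>\<nu>\<close> over the second. Forgetting
    \<open>\<pi>'\<close> leaves the lifted coupling.\<close>
  have lift: "\<exists>\<pi>\<in>couplings \<mu> \<nu>. map_pmf (map_prod \<phi> \<phi>) \<pi> = \<pi>'"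
    if "\<pi>' \<in> couplings (map_pmf \<phi> \<mu>) (map_pmf \<phi> \<nu>)" for \<pi>'
  proof -
    have "rel_pmf (=) (map_pmf \<phi> \<mu>) (map_pmf fst \<pi>')"
      using that by (simp add: couplings_def pmf.rel_eq)
    then obtain \<rho> where \<rho>: "\<And>u st. (u, st) \<in> set_pmf \<rho> \<Longrightarrow> \<phi> u = fst st"
        "map_pmf fst \<rho> = \<mu>" "map_pmf snd \<rho> = \<pi>'"
      unfolding pmf.rel_map by (elim rel_pmf.cases) auto
    have "map_pmf (\<lambda>z. snd (snd z)) \<rho> = map_pmf \<phi> \<nu>"
      using that \<rho>(3) by (auto simp: couplings_def pmf.map_comp comp_def)
    then have "rel_pmf (=) (map_pmf (\<lambda>z. snd (snd z)) \<rho>) (map_pmf \<phi> \<nu>)"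
      by (simp add: pmf.rel_eq)
    then obtain \<sigma> where \<sigma>: "\<And>z v. (z, v) \<in> set_pmf \<sigma> \<Longrightarrow> snd (snd z) = \<phi> v"
        "map_pmf fst \<sigma> = \<rho>" "map_pmf snd \<sigma> = \<nu>"
      unfolding pmf.rel_map by (elim rel_pmf.cases) auto
    have 1: "\<phi> (fst z) = fst (snd z)" "snd (snd z) = \<phi> v" if "(z, v) \<in> set_pmf \<sigma>" for z v
    proof -
      have "z \<in> set_pmf \<rho>" using that unfolding \<sigma>(2)[symmetric] by force
      then show "\<phi> (fst z) = fst (snd z)" using \<rho>(1)[of "fst z" "snd z"] by simp
    qed (use \<sigma>(1) that in blast)
    define \<pi> where "\<pi> = map_pmf (\<lambda>(z, v). (fst z, v)) \<sigma>"
    have "map_pmf fst \<pi> = map_pmf fst (map_pmf fst \<sigma>)" "map_pmf snd \<pi> = map_pmf snd \<sigma>"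
      by (simp_all add: \<pi>_def pmf.map_comp comp_def case_prod_beta)
    then have "\<pi> \<in> couplings \<mu> \<nu>" by (simp add: couplings_def \<sigma> \<rho>)
    moreover have "map_pmf (map_prod \<phi> \<phi>) \<pi> = map_pmf snd (map_pmf fst \<sigma>)"
      unfolding \<pi>_def pmf.map_comp
      by (intro map_pmf_cong refl) (use 1 in \<open>auto simp: prod_eq_iff\<close>)
    ultimately show ?thesis by (auto simp: \<sigma> \<rho>)
  qed
  have "(\<lambda>\<pi>. measure_pmf.expectation \<pi> (\<lambda>(x, y). d' x y)) ` couplings (map_pmf \<phi> \<mu>) (map_pmf \<phi> \<nu>)
      = (\<lambda>\<pi>. measure_pmf.expectation \<pi> (\<lambda>(x, y). d x y)) ` couplings \<mu> \<nu>"
    (is "?L = ?R")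
  proof
    show "?L \<subseteq> ?R"
    proof
      fix r assume "r \<in> ?L"
      then obtain \<pi>' where "\<pi>' \<in> couplings (map_pmf \<phi> \<mu>) (map_pmf \<phi> \<nu>)"
        and r: "r = measure_pmf.expectation \<pi>' (\<lambda>(x, y). d' x y)" by blast
      from lift[OF this(1)] obtain \<pi> where "\<pi> \<in> couplings \<mu> \<nu>" "map_pmf (map_prod \<phi> \<phi>) \<pi> = \<pi>'"
        by blast
      with E[of \<pi>] r show "r \<in> ?R" by auto
    qed
    show "?R \<subseteq> ?L"
    proof
      fix r assume "r \<in> ?R"
      then obtain \<pi> where "\<pi> \<in> couplings \<mu> \<nu>"
        and "r = measure_pmf.expectation \<pi> (\<lambda>(x, y). d x y)" by blast
      with E[of \<pi>] push[of \<pi>] show "r \<in> ?L"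
        by (intro image_eqI[where x = "map_pmf (map_prod \<phi> \<phi>) \<pi>"]) auto
    qed
  qed
  then show ?thesis by (simp add: wasserstein1_def)
qed

text \<open>The easy half of Kantorovich duality with complementary slackness: every coupling costs
  at least the difference of the two expectations of \<open>f\<close>, and \<open>\<pi>\<close>
  attains it. The Lipschitz bound is one-sided, from the first support to the second.\<close>

lemma wasserstein1_eq_potential:
  fixes f :: "'a \<Rightarrow> real"
  assumes fin: "finite (set_pmf \<mu>)" "finite (set_pmf \<nu>)"
    and lip: "\<And>u v. u \<in> set_pmf \<mu> \<Longrightarrow> v \<in> set_pmf \<nu> \<Longrightarrow> f v - f u \<le> d u v"
    and \<pi>: "\<pi> \<in> couplings \<mu> \<nu>"
    and tight: "\<And>u v. (u, v) \<in> set_pmf \<pi> \<Longrightarrow> d u v = f v - f u"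
  shows "wasserstein1 d \<mu> \<nu> = measure_pmf.expectation \<nu> f - measure_pmf.expectation \<mu> f"
proof -
  have sub: "set_pmf \<rho> \<subseteq> set_pmf \<mu> \<times> set_pmf \<nu>" if "\<rho> \<in> couplings \<mu> \<nu>" for \<rho>
    using that by (force simp: couplings_def)
  have int: "integrable (measure_pmf \<rho>) g" if "\<rho> \<in> couplings \<mu> \<nu>" for \<rho> and g :: "'a \<times> 'a \<Rightarrow> real"
    by (intro integrable_measure_pmf_finite finite_subset[OF sub[OF that]]) (use fin in auto)
  have E: "measure_pmf.expectation \<rho> (\<lambda>(u, v). f v - f u)
      = measure_pmf.expectation \<nu> f - measure_pmf.expectation \<mu> f"
    if "\<rho> \<in> couplings \<mu> \<nu>" for \<rho>
  proof -
    have "measure_pmf.expectation \<rho> (\<lambda>(u, v). f v - f u)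
        = measure_pmf.expectation (map_pmf snd \<rho>) f - measure_pmf.expectation (map_pmf fst \<rho>) f"
      by (simp add: case_prod_unfold int[OF that])
    then show ?thesis using that by (simp add: couplings_def del: integral_map_pmf)
  qed
  have "measure_pmf.expectation \<pi> (\<lambda>(u, v). d u v) = measure_pmf.expectation \<pi> (\<lambda>(u, v). f v - f u)"
    by (intro integral_cong_AE AE_pmfI) (use tight in auto)
  then have min: "measure_pmf.expectation \<pi> (\<lambda>(u, v). d u v)
      = measure_pmf.expectation \<nu> f - measure_pmf.expectation \<mu> f"
    using E[OF \<pi>] by simp
  have "measure_pmf.expectation \<nu> f - measure_pmf.expectation \<mu> f
      \<le> measure_pmf.expectation \<rho> (\<lambda>(u, v). d u v)" if "\<rho> \<in> couplings \<mu> \<nu>" for \<rho>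
    unfolding E[OF that, symmetric]
    by (intro integral_mono_AE AE_pmfI int that) (use sub[OF that] lip in force)
  then show ?thesis
    unfolding wasserstein1_def by (intro cInf_eq_minimum) (use \<pi> min[symmetric] in auto)
qed

text \<open>The points other than \<open>a\<close> carry at least the mass
  \<open>pmf \<nu> b\<close>, so they alone can supply \<open>b\<close>.\<close>

lemma ex_coupling_avoiding:
  assumes sum: "pmf \<mu> a + pmf \<nu> b \<le> 1" and lt: "pmf \<mu> a < 1" "pmf \<nu> b < 1"
  shows "\<exists>\<pi>\<in>couplings \<mu> \<nu>. (a, b) \<notin> set_pmf \<pi>"
proof -
  have compl: "measure_pmf.prob \<nu> (- {b}) = 1 - pmf \<nu> b"
    using measure_pmf.prob_compl[of "{b}" \<nu>] by (simp add: measure_pmf_single Compl_eq_Diff_UNIV)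
  have ne: "set_pmf \<nu> \<inter> - {b} \<noteq> {}"
  proof
    assume "set_pmf \<nu> \<inter> - {b} = {}"
    then have "measure_pmf.prob \<nu> (- {b}) = 0" by (simp add: measure_pmf_zero_iff)
    with compl lt show False by simp
  qed
  \<comment> \<open>Mass at \<open>a\<close> is spread according to \<open>\<nu>\<close> conditioned
    away from \<open>b\<close>. Elsewhere \<open>b\<close> is chosen with probability
    \<open>t\<close>, which solves \<open>(1 - pmf \<mu> a) * t = pmf \<nu> b\<close>.\<close>
  define \<nu>' where "\<nu>' = cond_pmf \<nu> (- {b})"
  define t where "t = pmf \<nu> b / (1 - pmf \<mu> a)"
  have t: "0 \<le> t" "t \<le> 1" using sum lt by (auto simp: t_def divide_simps)
  define m where "m = bind_pmf (bernoulli_pmf t) (\<lambda>c. if c then return_pmf b else \<nu>')"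
  define k where "k = (\<lambda>u. if u = a then \<nu>' else m)"
  define \<pi> where "\<pi> = bind_pmf \<mu> (\<lambda>u. map_pmf (Pair u) (k u))"
  have \<nu>': "pmf \<nu>' v = (if v = b then 0 else pmf \<nu> v / (1 - pmf \<nu> b))" for v
    by (simp add: \<nu>'_def pmf_cond[OF ne] compl)
  have m: "pmf m v = t * (if v = b then 1 else 0) + (1 - t) * pmf \<nu>' v" for v
    using t by (auto simp: m_def pmf_bind)
  have "map_pmf fst \<pi> = \<mu>"
    by (simp add: \<pi>_def map_bind_pmf pmf.map_comp comp_def map_pmf_const bind_return_pmf')
  moreover have "map_pmf snd \<pi> = \<nu>"
  proof (rule pmf_eqI)
    fix v
    have "pmf (map_pmf snd \<pi>) v = measure_pmf.expectation \<mu> (\<lambda>u. pmf (k u) v)"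
      by (simp add: \<pi>_def map_bind_pmf pmf.map_comp comp_def pmf_bind)
    also have "\<dots> = measure_pmf.expectation \<mu> (\<lambda>u. pmf m v + (pmf \<nu>' v - pmf m v) * indicator {a} u)"
      by (intro integral_cong_AE AE_pmfI) (auto simp: k_def)
    also have "\<dots> = pmf m v + (pmf \<nu>' v - pmf m v) * pmf \<mu> a"
      by (subst Bochner_Integration.integral_add)
        (auto intro!: integrable_mult_right integrable_real_indicator
          simp: measure_pmf_single measure_pmf.emeasure_eq_measure)
    also have "\<dots> = pmf \<nu> v"
      using lt by (auto simp: m \<nu>' t_def divide_simps) (simp_all add: algebra_simps)
    finally show "pmf (map_pmf snd \<pi>) v = pmf \<nu> v" .
  qed
  moreover have "b \<notin> set_pmf \<nu>'" using \<nu>'[of b] by (simp add: set_pmf_iff)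
  then have "(a, b) \<notin> set_pmf \<pi>" by (auto simp: \<pi>_def k_def)
  ultimately show ?thesis by (auto simp: couplings_def)
qed

section \<open>Curvature of bridges\<close>

lemma adj_sym: "adj G x y \<longleftrightarrow> adj G y x"
  by (simp add: adj_def insert_commute)

lemma adjD:
  assumes "simple_graph G" "adj G x y"
  shows "x \<in> verts G" "y \<in> verts G" "x \<noteq> y"
  using assms by (fastforce simp: adj_def simple_graph_def doubleton_eq_iff)+

lemma relpowp_map:
  assumes "(R ^^ n) a b" and "\<And>x y. R x y \<Longrightarrow> S (f x) (f y) \<or> f x = f y"
  shows "\<exists>m\<le>n. (S ^^ m) (f a) (f b)"
  using assms(1)
proof (induction n arbitrary: b)
  case (Suc n)
  then obtain c where c: "(R ^^ n) a c" "R c b" by (auto elim: relpowp_Suc_E)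
  then obtain m where m: "m \<le> n" "(S ^^ m) (f a) (f c)" using Suc.IH by blast
  from assms(2)[OF c(2)] show ?case
  proof
    assume "S (f c) (f b)"
    with m have "(S ^^ Suc m) (f a) (f b)" by (auto intro: relpowp_Suc_I)
    with m show ?thesis by (meson Suc_le_mono)
  next
    assume "f c = f b"
    with m show ?thesis by (metis le_SucI)
  qed
qed auto

lemma gdist_le: "(adj G ^^ n) x y \<Longrightarrow> gdist G x y \<le> n"
  by (simp add: gdist_def Least_le)

lemma relpowp_gdist:
  assumes "(adj G)\<^sup>*\<^sup>* x y"
  shows "(adj G ^^ gdist G x y) x y"
  using rtranclp_imp_relpowp[OF assms] unfolding gdist_def by (intro LeastI_ex[of "\<lambda>n. (adj G ^^ n) x y"])

text \<open>Reachability in \<open>H\<close> is recorded as well, because \<open>gdist\<close>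
  carries no information about pairs that no walk joins.\<close>

lemma gdist_map_le:
  assumes "(adj G)\<^sup>*\<^sup>* a b" and "\<And>x y. adj G x y \<Longrightarrow> adj H (f x) (f y) \<or> f x = f y"
  shows "gdist H (f a) (f b) \<le> gdist G a b" and "(adj H)\<^sup>*\<^sup>* (f a) (f b)"
proof -
  obtain m where "m \<le> gdist G a b" "(adj H ^^ m) (f a) (f b)"
    using relpowp_map[OF relpowp_gdist[OF assms(1)], of "adj H" f] assms(2) by blast
  then show "gdist H (f a) (f b) \<le> gdist G a b" "(adj H)\<^sup>*\<^sup>* (f a) (f b)"
    using gdist_le[of m H "f a" "f b"] by (auto intro: relpowp_imp_rtranclp)
qed

lemma lipschitz_gdist:
  fixes f :: "'a \<Rightarrow> real"
  assumes "(adj G)\<^sup>*\<^sup>* a b" and lip: "\<And>x y. adj G x y \<Longrightarrow> f y - f x \<le> 1"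
  shows "f b - f a \<le> real (gdist G a b)"
proof -
  have "f b - f a \<le> real n" if "(adj G ^^ n) a b" for n b
    using that
  proof (induction n arbitrary: b)
    case (Suc n)
    then obtain c where "(adj G ^^ n) a c" "adj G c b" by (auto elim: relpowp_Suc_E)
    with Suc.IH[of c] lip[of c b] show ?case by simp
  qed auto
  from this[OF relpowp_gdist[OF assms(1)]] show ?thesis .
qed

lemma wdeg_pos:
  assumes "simple_graph G" "finite (verts G)" "positive_weight G w" "adj G x y"
  shows "0 < wdeg G w x"
  unfolding wdeg_def
  by (rule sum_pos) (use assms finite_nbrs[OF assms(1,2)] in \<open>auto simp: nbrs_def adj_def positive_weight_def\<close>)

lemma set_lazy_walk:
  assumes "simple_graph G" "finite (verts G)" "positive_weight G w" "adj G x y" "0 \<le> \<alpha>" "\<alpha> \<le> 1"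
  shows "set_pmf (lazy_walk G w \<alpha> x) \<subseteq> insert x (nbrs G x)"
proof
  fix z assume "z \<in> set_pmf (lazy_walk G w \<alpha> x)"
  moreover have "nbrs G x \<noteq> {}" using assms(4) by (auto simp: nbrs_def)
  ultimately show "z \<in> insert x (nbrs G x)"
    using pmf_lazy_walk[OF assms(1) finite_nbrs[OF assms(1,2)] _ assms(3,5,6), of x z]
    by (auto simp: set_pmf_iff nbrs_def split: if_splits)
qed

lemma expectation_lazy_walk:
  fixes f :: "'a \<Rightarrow> real"
  assumes "simple_graph G" "finite (verts G)" "positive_weight G w" "adj G x y" "0 \<le> \<alpha>" "\<alpha> \<le> 1"
  shows "measure_pmf.expectation (lazy_walk G w \<alpha> x) f
    = \<alpha> * f x + (1 - \<alpha>) / wdeg G w x * (\<Sum>z\<in>nbrs G x. w {x, z} * f z)"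
proof -
  have ne: "nbrs G x \<noteq> {}" using assms by (auto simp: nbrs_def)
  note fin = finite_nbrs[OF assms(1,2), of x]
  note pmf = pmf_lazy_walk[OF assms(1) fin ne assms(3,5,6)]
  have x: "x \<notin> nbrs G x" using adjD(3)[OF assms(1), of x x] by (auto simp: nbrs_def)
  have "measure_pmf.expectation (lazy_walk G w \<alpha> x) f
      = (\<Sum>z\<in>insert x (nbrs G x). f z * pmf (lazy_walk G w \<alpha> x) z)"
    by (rule integral_measure_pmf_real) (use fin set_lazy_walk[OF assms] in auto)
  also have "\<dots> = \<alpha> * f x + (\<Sum>z\<in>nbrs G x. f z * pmf (lazy_walk G w \<alpha> x) z)"
    using fin x by (simp add: pmf)
  also have "(\<Sum>z\<in>nbrs G x. f z * pmf (lazy_walk G w \<alpha> x) z)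
      = (\<Sum>z\<in>nbrs G x. (1 - \<alpha>) / wdeg G w x * (w {x, z} * f z))"
    by (rule sum.cong) (use x in \<open>auto simp: pmf nbrs_def\<close>)
  finally show ?thesis by (simp add: sum_distrib_left)
qed

text \<open>The potential taking the values \<open>-1\<close>, \<open>0\<close>, \<open>1\<close>, \<open>2\<close> across the bridge is optimal, because for
  \<open>\<alpha>\<close> near 1 some coupling avoids transporting mass from \<open>y\<close> back to \<open>x\<close>.\<close>

lemma kappa_LLY_bridge:
  assumes G: "simple_graph G" "finite (verts G)" and w: "positive_weight G w"
    and xy: "adj G x y" "y \<in> T" "x \<notin> T"
    and cut: "\<And>a b. adj G a b \<Longrightarrow> a \<in> T \<Longrightarrow> b \<notin> T \<Longrightarrow> a = y \<and> b = x"
  shows "kappa_LLY G w x y = 2 * (w {x, y} / wdeg G w x + w {x, y} / wdeg G w y) - 2"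
proof -
  define p where "p = w {x, y} / wdeg G w x"
  define q where "q = w {x, y} / wdeg G w y"
  have yx: "adj G y x" using xy(1) by (simp add: adj_sym)
  note deg = wdeg_pos[OF G w xy(1)] wdeg_pos[OF G w yx]
  note fin = finite_nbrs[OF G]
  have wpos: "0 < w {a, b}" if "adj G a b" for a b
    using that w by (auto simp: adj_def positive_weight_def)
  have le1: "w {a, b} / wdeg G w a \<le> 1" if "adj G a b" for a b
  proof -
    have "w {a, b} \<le> wdeg G w a"
      unfolding wdeg_def by (rule member_le_sum[of b "nbrs G a" "\<lambda>b. w {a, b}"])
        (use that fin wpos in \<open>auto simp: nbrs_def intro: less_imp_le\<close>)
    then show ?thesis using wdeg_pos[OF G w that] by simp
  qed
  have p: "0 < p" "p \<le> 1" and q: "0 < q" "q \<le> 1"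
    using deg wpos[OF xy(1)] le1[OF xy(1)] le1[OF yx]
    by (auto simp: p_def q_def insert_commute)
  have xney: "x \<noteq> y" using xy by auto
  define f :: "'a \<Rightarrow> real" where
    "f = (\<lambda>z. if z = x then 0 else if z = y then 1 else if z \<in> T then 2 else -1)"
  have f_x: "f x = 0" and f_y: "f y = 1" using xney by (auto simp: f_def)
  \<comment> \<open>On the side of \<open>x\<close> the values are -1 and 0, on the side of
    \<open>y\<close> they are 1 and 2, and the only edge between the sides joins the values 0 and
    1.\<close>
  have lip: "f b - f a \<le> 1" if "adj G a b" for a b
  proof -
    have "adj G b a" using that by (simp add: adj_sym)
    then show ?thesis
      using that cut[of a b] cut[of b a] xy by (cases "a \<in> T"; cases "b \<in> T") (auto simp: f_def)
  qed
  have fNx: "f z = -1" if "z \<in> nbrs G x - {y}" for z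
    using that cut[of z x] xy adjD(3)[OF G(1), of x z] by (auto simp: f_def nbrs_def adj_sym)
  have fNy: "f z = 2" if "z \<in> nbrs G y - {x}" for z
    using that cut[of y z] xy adjD(3)[OF G(1), of y z] by (auto simp: f_def nbrs_def)
  \<comment> \<open>The pair \<open>(y, x)\<close> is left out: there \<open>f v - f u\<close> is -1
    while the distance is 1.\<close>
  have dist: "real (gdist G u v) = f v - f u"
    if "u \<in> insert x (nbrs G x)" "v \<in> insert y (nbrs G y)" "(u, v) \<noteq> (y, x)" for u v
  proof -
    have step1: "(adj G ^^ 1) a b" if "adj G a b" for a b using that by auto
    have step2: "(adj G ^^ 2) a b" if "adj G a c" "adj G c b" for a b c
      using that by (auto simp: numeral_2_eq_2)
    have step3: "(adj G ^^ 3) a b" if "adj G a c" "adj G c d" "adj G d b" for a b c d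
      using that by (auto simp: numeral_3_eq_3)
    have step0: "(adj G ^^ 0) a a" for a by simp
    have cases: "u = x \<or> u = y \<or> u \<in> nbrs G x - {y}" "v = y \<or> v = x \<or> v \<in> nbrs G y - {x}"
      "\<not> (u = y \<and> v = x)"
      using that by auto
    consider "u = x" "v = y" | "u = x" "v = x" | "u = x" "v \<in> nbrs G y - {x}"
      | "u = y" "v = y" | "u = y" "v \<in> nbrs G y - {x}"
      | "u \<in> nbrs G x - {y}" "v = y" | "u \<in> nbrs G x - {y}" "v = x"
      | "u \<in> nbrs G x - {y}" "v \<in> nbrs G y - {x}"
      using cases by blast
    \<comment> \<open>An explicit walk bounds the distance from above, and the Lipschitz bound for
      \<open>f\<close> shows that it is shortest.\<close>
    then have "\<exists>n. (adj G ^^ n) u v \<and> f v - f u = real n"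
    proof cases
      case 1 then show ?thesis using step1[OF xy(1)] f_x f_y by (intro exI[of _ 1]) auto
    next
      case 2 then show ?thesis using step0 f_x by (intro exI[of _ 0]) auto
    next
      case 3
      then show ?thesis using step2[OF xy(1), of v] fNy[of v] f_x
        by (intro exI[of _ 2]) (auto simp: nbrs_def)
    next
      case 4 then show ?thesis using step0 by (intro exI[of _ 0]) auto
    next
      case 5
      then show ?thesis using fNy[of v] f_y
        by (intro exI[of _ 1]) (auto simp: nbrs_def)
    next
      case 6
      then show ?thesis using step2[of u x y] xy(1) fNx[of u] f_y
        by (intro exI[of _ 2]) (auto simp: nbrs_def adj_sym)
    next
      case 7
      then show ?thesis using fNx[of u] f_x
        by (intro exI[of _ 1]) (auto simp: nbrs_def adj_sym)
    next
      case 8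
      then show ?thesis using step3[of u x y v] xy(1) fNx[of u] fNy[of v]
        by (intro exI[of _ 3]) (auto simp: nbrs_def adj_sym)
    qed
    then obtain n where n: "(adj G ^^ n) u v" "f v - f u = real n" by blast
    have "f v - f u \<le> real (gdist G u v)"
      by (rule lipschitz_gdist[OF relpowp_imp_rtranclp[OF n(1)] lip])
    with gdist_le[OF n(1)] n(2) show ?thesis by simp
  qed
  have sums: "(\<Sum>z\<in>nbrs G x. w {x, z} * f z) = 2 * w {x, y} - wdeg G w x"
    "(\<Sum>z\<in>nbrs G y. w {y, z} * f z) = 2 * wdeg G w y - 2 * w {x, y}"
  proof -
    have "(\<Sum>z\<in>nbrs G x. w {x, z} * f z)
        = w {x, y} + (\<Sum>z\<in>nbrs G x - {y}. w {x, z} * f z)"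
      using xy(1) f_y fin by (simp add: sum.remove[of _ y] nbrs_def)
    also have "(\<Sum>z\<in>nbrs G x - {y}. w {x, z} * f z) = (\<Sum>z\<in>nbrs G x - {y}. - w {x, z})"
      by (rule sum.cong) (use fNx in auto)
    also have "\<dots> = w {x, y} - wdeg G w x"
      using xy(1) fin by (simp add: wdeg_def sum.remove[of _ y "\<lambda>z. w {x, z}"] nbrs_def sum_negf)
    finally show "(\<Sum>z\<in>nbrs G x. w {x, z} * f z) = 2 * w {x, y} - wdeg G w x" by simp
    have "(\<Sum>z\<in>nbrs G y. w {y, z} * f z) = (\<Sum>z\<in>nbrs G y - {x}. w {y, z} * f z)"
      using yx f_x fin by (simp add: sum.remove[of _ x] nbrs_def)
    also have "\<dots> = (\<Sum>z\<in>nbrs G y - {x}. 2 * w {y, z})"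
      by (rule sum.cong) (use fNy in auto)
    also have "\<dots> = 2 * (\<Sum>z\<in>nbrs G y - {x}. w {y, z})" by (simp add: sum_distrib_left)
    also have "(\<Sum>z\<in>nbrs G y - {x}. w {y, z}) = wdeg G w y - w {y, x}"
      unfolding wdeg_def using yx fin by (subst sum.remove[of "nbrs G y" x]) (auto simp: nbrs_def)
    finally show "(\<Sum>z\<in>nbrs G y. w {y, z} * f z) = 2 * wdeg G w y - 2 * w {x, y}"
      by (simp add: insert_commute)
  qed
  \<comment> \<open>For \<open>\<alpha> > 1/2\<close> the masses that the two walks put on
    \<open>y\<close> and \<open>x\<close> add up to at most 1, so a coupling avoiding
    \<open>(y, x)\<close> exists. The quotient is constant on this range, which makes the limit
    immediate.\<close>
  have kap: "kappa G w \<alpha> x y / (1 - \<alpha>) = 2 * (p + q) - 2" if \<alpha>: "1/2 < \<alpha>" "\<alpha> < 1" for \<alpha>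
  proof -
    let ?\<mu> = "lazy_walk G w \<alpha> x" and ?\<nu> = "lazy_walk G w \<alpha> y"
    have \<alpha>01: "0 \<le> \<alpha>" "\<alpha> \<le> 1" using \<alpha> by auto
    note supp = set_lazy_walk[OF G w xy(1) \<alpha>01] set_lazy_walk[OF G w yx \<alpha>01]
    have pmf: "pmf ?\<mu> y = (1 - \<alpha>) * p" "pmf ?\<nu> x = (1 - \<alpha>) * q"
      using xy(1) yx xney pmf_lazy_walk[OF G(1) fin _ w \<alpha>01, of x y] pmf_lazy_walk[OF G(1) fin _ w \<alpha>01, of y x]
      by (auto simp: nbrs_def p_def q_def insert_commute)
    have le: "(1 - \<alpha>) * p \<le> 1 - \<alpha>" "(1 - \<alpha>) * q \<le> 1 - \<alpha>"
      using p q \<alpha> by (auto simp: mult_le_cancel_left1)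
    have "pmf ?\<mu> y + pmf ?\<nu> x \<le> 1" "pmf ?\<mu> y < 1" "pmf ?\<nu> x < 1"
      unfolding pmf using le \<alpha> by linarith+
    then obtain \<pi> where \<pi>: "\<pi> \<in> couplings ?\<mu> ?\<nu>" "(y, x) \<notin> set_pmf \<pi>"
      using ex_coupling_avoiding[of ?\<mu> y ?\<nu> x] by blast
    have "wasserstein1 (\<lambda>u v. real (gdist G u v)) ?\<mu> ?\<nu>
      = measure_pmf.expectation ?\<nu> f - measure_pmf.expectation ?\<mu> f"
    proof (rule wasserstein1_eq_potential[OF _ _ _ \<pi>(1)])
      show "finite (set_pmf ?\<mu>)" "finite (set_pmf ?\<nu>)"
        using supp fin by (auto intro: finite_subset)
    next
      fix u v assume "u \<in> set_pmf ?\<mu>" "v \<in> set_pmf ?\<nu>"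
      with supp have "u \<in> insert x (nbrs G x)" "v \<in> insert y (nbrs G y)" by auto
      from dist[OF this] show "f v - f u \<le> real (gdist G u v)"
        using f_x f_y by (cases "(u, v) = (y, x)") auto
    next
      fix u v assume uv: "(u, v) \<in> set_pmf \<pi>"
      then have "u \<in> set_pmf (map_pmf fst \<pi>)" "v \<in> set_pmf (map_pmf snd \<pi>)" by force+
      then have "u \<in> set_pmf ?\<mu>" "v \<in> set_pmf ?\<nu>" using \<pi>(1) by (simp_all add: couplings_def del: set_map_pmf)
      with supp uv \<pi>(2) show "real (gdist G u v) = f v - f u" by (intro dist) auto
    qed
    also have "\<dots> = 1 - (1 - \<alpha>) * (2 * (p + q) - 2)"
      using deg unfolding expectation_lazy_walk[OF G w xy(1) \<alpha>01] expectation_lazy_walk[OF G w yx \<alpha>01]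
        sums f_x f_y p_def q_def
      by (simp add: divide_simps) (simp add: algebra_simps)
    finally show ?thesis using \<alpha> by (simp add: kappa_def)
  qed
  have "eventually (\<lambda>\<alpha>. \<alpha> \<in> {1/2<..<1}) (at_left (1::real))"
    by (rule eventually_at_left_real) auto
  then have "eventually (\<lambda>\<alpha>. kappa G w \<alpha> x y / (1 - \<alpha>) = 2 * (p + q) - 2) (at_left 1)"
    by eventually_elim (rule kap, auto)
  then have "((\<lambda>\<alpha>. kappa G w \<alpha> x y / (1 - \<alpha>)) \<longlongrightarrow> 2 * (p + q) - 2) (at_left 1)"
    by (rule tendsto_eventually)
  then show ?thesis unfolding kappa_LLY_def p_def q_def
    by (intro tendsto_Lim) auto
qed

section \<open>The 2-core and the attached trees\<close>

locale core_graph =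
  fixes G :: "'a ugraph"
  assumes simple: "simple_graph G" and fin: "finite (verts G)"
    and conn: "connected_graph G" and core_ne: "verts (core2 G) \<noteq> {}"
begin

abbreviation "K \<equiv> verts (core2 G)"

lemma core2: "is_core2 G (core2 G)"
  unfolding core2_def by (rule theI'[OF ex1_is_core2[OF simple fin]])

lemma core_sub: "K \<subseteq> verts G" and core_adj: "adj (core2 G) x y \<Longrightarrow> adj G x y"
  and core_simple: "simple_graph (core2 G)" and core_deg: "x \<in> K \<Longrightarrow> 2 \<le> card (nbrs (core2 G) x)"
proof -
  have "subgraph (core2 G) G" "min_degree_ge2 (core2 G)"
    using core2 unfolding is_core2_def by blast+
  then show "K \<subseteq> verts G" "adj (core2 G) x y \<Longrightarrow> adj G x y" "simple_graph (core2 G)"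
    "x \<in> K \<Longrightarrow> 2 \<le> card (nbrs (core2 G) x)"
    by (auto simp: subgraph_def adj_def min_degree_ge2_def)
qed

lemma core_fin: "finite K"
  using core_sub fin finite_subset by blast

lemma reach: "x \<in> verts G \<Longrightarrow> y \<in> verts G \<Longrightarrow> (adj G)\<^sup>*\<^sup>* x y"
  using conn by (simp add: connected_graph_def)

text \<open>The subgraph induced on \<open>S\<close> has minimum degree at least 2 and contains the
  core, so maximality forces equality. Taking \<open>S = K\<close> in the second conclusion shows
  that the core is an induced subgraph.\<close>

lemma core_max:
  assumes S: "K \<subseteq> S" "S \<subseteq> verts G"
    and deg: "\<And>u. u \<in> S - K \<Longrightarrow> \<exists>a b. a \<in> S \<and> b \<in> S \<and> a \<noteq> b \<and> adj G u a \<and> adj G u b"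
  shows "S = K" and "a \<in> S \<Longrightarrow> b \<in> S \<Longrightarrow> adj G a b \<Longrightarrow> adj (core2 G) a b"
proof -
  define H where "H = \<lparr>verts = S, edges = {e \<in> edges G. e \<subseteq> S}\<rparr>"
  have adjH: "adj H u v \<longleftrightarrow> adj G u v \<and> u \<in> S \<and> v \<in> S" for u v
    by (auto simp: adj_def H_def)
  have "simple_graph H"
    unfolding simple_graph_def
  proof
    fix e assume e: "e \<in> edges H"
    then obtain x y where "x \<noteq> y" "e = {x, y}"
      using simple by (auto simp: H_def simple_graph_def)
    with e show "\<exists>x y. x \<in> verts H \<and> y \<in> verts H \<and> x \<noteq> y \<and> e = {x, y}"
      by (auto simp: H_def)
  qed
  then have H: "subgraph H G" using S by (auto simp: subgraph_def H_def)
  have KH: "subgraph (core2 G) H"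
    unfolding subgraph_def
  proof (intro conjI core_simple)
    show "K \<subseteq> verts H" using S by (simp add: H_def)
    show "edges (core2 G) \<subseteq> edges H"
    proof
      fix e assume e: "e \<in> edges (core2 G)"
      then have "e \<subseteq> K" using core_simple by (auto simp: simple_graph_def)
      moreover have "e \<in> edges G" using e core2 unfolding is_core2_def subgraph_def by blast
      ultimately show "e \<in> edges H" using S by (auto simp: H_def)
    qed
  qed
  have finH: "finite (nbrs H u)" for u
    by (rule finite_subset[OF _ finite_nbrs[OF simple fin, of u]]) (auto simp: nbrs_def adjH)
  have "2 \<le> card (nbrs H u)" if "u \<in> S" for u
  proof (cases "u \<in> K")
    case True
    have "nbrs (core2 G) u \<subseteq> nbrs H u"
      using KH by (auto simp: nbrs_def adj_def subgraph_def)
    with core_deg[OF True] card_mono[OF finH] show ?thesis by (meson le_trans)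
  next
    case False
    with deg that obtain a b where "a \<in> S" "b \<in> S" "a \<noteq> b" "adj G u a" "adj G u b" by blast
    then have "{a, b} \<subseteq> nbrs H u" "card {a, b} = 2" using that by (auto simp: nbrs_def adjH)
    with card_mono[OF finH, of "{a, b}" u] show ?thesis by simp
  qed
  then have "min_degree_ge2 H" by (simp add: min_degree_ge2_def H_def)
  with H KH core2 have eq: "H = core2 G" unfolding is_core2_def by blast
  show "S = K" by (simp flip: eq add: H_def)
  show "adj (core2 G) a b" if "a \<in> S" "b \<in> S" "adj G a b"
    unfolding eq[symmetric] adjH using that by simp
qed

lemma core_induced: "x \<in> K \<Longrightarrow> y \<in> K \<Longrightarrow> adj G x y \<Longrightarrow> adj (core2 G) x y"
  using core_max(2)[of K x y] core_sub by blast

section \<open>Heights, parents and roots in the attached trees\<close>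

definition height :: "'a \<Rightarrow> nat" where
  "height v = (LEAST n. \<exists>k\<in>K. (adj G ^^ n) v k)"

lemma height_core: "v \<in> K \<Longrightarrow> height v = 0"
  unfolding height_def by (rule Least_eq_0) auto

lemma height_pred:
  assumes "v \<in> verts G" "v \<notin> K"
  shows "\<exists>u. adj G v u \<and> height v = Suc (height u)"
proof -
  have ex: "\<exists>n. \<exists>k\<in>K. (adj G ^^ n) u k" if "u \<in> verts G" for u
    using core_ne core_sub reach[OF that] by (metis equals0I rtranclp_imp_relpowp subsetD)
  obtain k where k: "k \<in> K" "(adj G ^^ height v) v k"
    using LeastI_ex[OF ex[OF assms(1)]] unfolding height_def by blast
  obtain n where n: "height v = Suc n" using k assms(2) by (cases "height v") auto
  then obtain u where u: "adj G v u" "(adj G ^^ n) u k"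
    using k(2) relpowp_Suc_D2[of n "adj G" v k] by auto
  have "height u \<le> n" unfolding height_def by (rule Least_le) (use u k in blast)
  moreover obtain k' where k': "k' \<in> K" "(adj G ^^ height u) u k'"
    using LeastI_ex[OF ex[OF adjD(2)[OF simple u(1)]]] unfolding height_def by blast
  have "(adj G ^^ Suc (height u)) v k'" using relpowp_Suc_I2[OF u(1) k'(2)] .
  then have "height v \<le> Suc (height u)"
    unfolding height_def[of v] by (intro Least_le) (use k' in blast)
  ultimately show ?thesis using u n by (intro exI[of _ u]) auto
qed

text \<open>Two such neighbours, together with their descending walks to the core, would enlarge the core.\<close>

lemma height_pred_unique:
  assumes v: "v \<notin> K" and a: "adj G v a" "height a \<le> height v" and b: "adj G v b" "height b \<le> height v"
  shows "a = b"
proof (rule ccontr)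
  assume "a \<noteq> b"
  \<comment> \<open>\<open>D\<close> is a strictly descending step; \<open>S\<close> adds to the
    core everything reached by descending from \<open>v\<close>, \<open>a\<close> or
    \<open>b\<close>.\<close>
  define D where "D = (\<lambda>x y. adj G x y \<and> height y < height x)"
  define S where "S = K \<union> {u. \<exists>s\<in>{v, a, b}. D\<^sup>*\<^sup>* s u}"
  have V: "u \<in> verts G" if "D\<^sup>*\<^sup>* s u" "s \<in> {v, a, b}" for s u
    using that by (induction) (use adjD[OF simple] a b in \<open>auto simp: D_def\<close>)
  have "S = K"
  proof (rule core_max(1))
    show "K \<subseteq> S" by (simp add: S_def)
    show "S \<subseteq> verts G" using core_sub V by (auto simp: S_def)
  next
    fix u assume u: "u \<in> S - K"
    then obtain s where s: "s \<in> {v, a, b}" "D\<^sup>*\<^sup>* s u" by (auto simp: S_def)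
    obtain c where "adj G u c" "height u = Suc (height c)" using height_pred[of u] V[OF s(2,1)] u by blast
    then have c: "D u c" by (simp add: D_def)
    have cS: "c \<in> S" unfolding S_def using s rtranclp.rtrancl_into_rtrancl[OF s(2) c] by blast
    have base: "v \<in> S" "a \<in> S" "b \<in> S" by (auto simp: S_def)
    \<comment> \<open>Two neighbours in \<open>S\<close>: \<open>v\<close> has \<open>a\<close> and
      \<open>b\<close>; \<open>a\<close> and \<open>b\<close> have \<open>v\<close> and the lower
      neighbour \<open>c\<close>; any other vertex has \<open>c\<close> and the vertex
      \<open>d\<close> from which the descent reached it. Heights show that the two differ.\<close>
    consider "u = v" | "u = a \<or> u = b" | "u \<noteq> v" "u \<noteq> a" "u \<noteq> b" by blast
    then show "\<exists>a b. a \<in> S \<and> b \<in> S \<and> a \<noteq> b \<and> adj G u a \<and> adj G u b"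
    proof cases
      case 1
      then show ?thesis using base a b \<open>a \<noteq> b\<close> by blast
    next
      case 2
      then have "adj G u v" "c \<noteq> v" using a b c by (auto simp: adj_sym D_def)
      then show ?thesis using base cS c by (auto simp: D_def)
    next
      case 3
      then obtain d where d: "D\<^sup>*\<^sup>* s d" "D d u" using s by (auto elim: rtranclp.cases)
      then have "d \<in> S" "adj G u d" "d \<noteq> c" using s(1) c by (auto simp: S_def D_def adj_sym)
      then show ?thesis using cS c by (auto simp: D_def)
    qed
  qed
  with v show False by (auto simp: S_def)
qed

text \<open>The identity on the core, so that iterating past the root of a tree does no
  harm.\<close>

definition parent :: "'a \<Rightarrow> 'a" where
  "parent v = (if v \<in> verts G - K then SOME u. adj G v u \<and> height v = Suc (height u) else v)"

lemma parent:
  assumes "v \<in> verts G" "v \<notin> K"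
  shows "adj G v (parent v)" "height v = Suc (height (parent v))"
proof -
  have "parent v = (SOME u. adj G v u \<and> height v = Suc (height u))"
    using assms by (simp add: parent_def)
  then show "adj G v (parent v)" "height v = Suc (height (parent v))"
    using someI_ex[OF height_pred[OF assms]] by metis+
qed

lemma parent_core [simp]: "v \<in> K \<Longrightarrow> parent v = v"
  by (simp add: parent_def)

lemma parent_unique:
  assumes "v \<notin> K" "adj G v u" "height u \<le> height v"
  shows "u = parent v"
  using height_pred_unique[OF assms(1), of u "parent v"] parent[of v] assms adjD[OF simple assms(2)]
  by auto

text \<open>Of two adjacent vertices not both in the core, one of maximal height lies outside the
  core, and the other is then its parent by uniqueness. Hence the edges outside the core form a
  forest.\<close>

lemma adj_cases [consumes 1, case_names core child parent]:
  assumes "adj G u v"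
  obtains "u \<in> K" "v \<in> K" "adj (core2 G) u v"
  | "u \<notin> K" "v = parent u" | "v \<notin> K" "u = parent v"
proof -
  have vu: "adj G v u" using assms by (simp add: adj_sym)
  note V = adjD[OF simple assms]
  show thesis
  proof (cases "u \<in> K \<and> v \<in> K")
    case True
    then show thesis using core_induced[OF _ _ assms] that by blast
  next
    case False
    have pos: "z \<in> K" if "z \<in> verts G" "height z = 0" for z
      using parent(2)[OF that(1)] that(2) by fastforce
    show thesis
    proof (cases "height v \<le> height u")
      case True
      have "u \<notin> K"
      proof
        assume "u \<in> K"
        with True pos[OF V(2)] False show False by (simp add: height_core)
      qed
      then show thesis using parent_unique[OF _ assms True] that(2) by blast
    next
      case f: False
      then have "v \<notin> K" by (metis height_core le0)
      then show thesis using parent_unique[OF _ vu] f that(3) nat_le_linear by blast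
    qed
  qed
qed

text \<open>Each parent step lowers the height of a tree vertex by one, so \<open>height v\<close>
  steps end at the core vertex from which its tree hangs.\<close>

definition root :: "'a \<Rightarrow> 'a" where
  "root v = (parent ^^ height v) v"

lemma root_core [simp]: "v \<in> K \<Longrightarrow> root v = v"
  by (simp add: root_def height_core)

lemma root_parent: "root (parent v) = root v"
proof (cases "v \<in> verts G - K")
  case True
  then show ?thesis
    using parent(2)[of v] by (simp add: root_def funpow_Suc_right del: funpow.simps(2))
qed (auto simp: parent_def)

lemma root_nbr:
  assumes "x \<in> K" "adj G x u" "u \<notin> K"
  shows "parent u = x" "root u = x" "x \<in> attach_set G"
proof -
  from assms(2) show "parent u = x" by (cases rule: adj_cases) (use assms in auto)
  with root_parent[of u] assms show "root u = x" by simp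
  show "x \<in> attach_set G"
    using assms adjD[OF simple assms(2)] by (auto simp: attach_set_def)
qed

text \<open>The side \<open>T\<close> consists of the descendants of \<open>v\<close>. Parent steps
  never raise the height, so \<open>parent v\<close> is not among them, and by
  \<open>adj_cases\<close> no other edge leaves \<open>T\<close>. This is the cut that the bridge
  formula asks for.\<close>

lemma tree_edge_cut:
  assumes v: "v \<in> verts G" "v \<notin> K"
  shows "\<exists>T. v \<in> T \<and> parent v \<notin> T \<and> (\<forall>a b. adj G a b \<longrightarrow> a \<in> T \<longrightarrow> b \<notin> T \<longrightarrow> a = v \<and> b = parent v)"
proof (intro exI conjI allI impI)
  let ?T = "{z. \<exists>n. (parent ^^ n) z = v}"
  show "v \<in> ?T" by (auto intro: exI[of _ 0])
  have h: "height ((parent ^^ n) z) \<le> height z" for n z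
  proof (induction n)
    case (Suc n)
    have "height (parent u) \<le> height u" for u
      using parent(2)[of u] by (cases "u \<in> verts G - K") (auto simp: parent_def)
    with Suc show ?case by (auto intro: le_trans)
  qed auto
  show "parent v \<notin> ?T"
  proof
    assume "parent v \<in> ?T"
    then obtain n where "(parent ^^ n) (parent v) = v" by blast
    with h[of n "parent v"] parent(2)[OF v] show False by simp
  qed
  fix a b assume ab: "adj G a b" "a \<in> ?T" "b \<notin> ?T"
  have K: "(parent ^^ n) z = z" if "z \<in> K" for z n using that by (induction n) auto
  from ab(1) have "a = v \<and> b = parent v"
  proof (cases rule: adj_cases)
    case core
    then show ?thesis using ab(2) v by (auto simp: K)
  next
    case child
    from ab(2) obtain n where n: "(parent ^^ n) a = v" by blast
    show ?thesis
    proof (cases n)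
      case (Suc m)
      then have "(parent ^^ m) b = v" using n child by (simp add: funpow_Suc_right del: funpow.simps(2))
      then show ?thesis using ab(3) by blast
    qed (use n child in auto)
  next
    case parent
    from ab(2) obtain n where "(parent ^^ n) a = v" by blast
    then have "(parent ^^ Suc n) b = v" using parent by (simp add: funpow_Suc_right del: funpow.simps(2))
    then show ?thesis using ab(3) by blast
  qed
  then show "a = v" "b = parent v" by auto
qed

end

section \<open>Collapsing the trees to pendant vertices\<close>

context core_graph
begin

abbreviation "P \<equiv> pendant_core G"

lemma attach_core: "x \<in> attach_set G \<Longrightarrow> x \<in> K"
  by (simp add: attach_set_def)

lemma attach_nbr: "x \<in> attach_set G \<Longrightarrow> \<exists>u. adj G x u \<and> u \<notin> K"
  by (auto simp: attach_set_def)

lemma adj_pendant_core: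
  "adj P s t \<longleftrightarrow> (\<exists>x y. s = Inl x \<and> t = Inl y \<and> adj (core2 G) x y)
    \<or> (\<exists>x\<in>attach_set G. s = Inl x \<and> t = Inr x \<or> s = Inr x \<and> t = Inl x)"
proof -
  have "{s, t} \<in> (\<lambda>e. Inl ` e) ` edges (core2 G)
      \<longleftrightarrow> (\<exists>x y. s = Inl x \<and> t = Inl y \<and> adj (core2 G) x y)" (is "?L \<longleftrightarrow> ?R")
  proof
    assume ?L
    then obtain e where e: "e \<in> edges (core2 G)" "{s, t} = Inl ` e" by (rule imageE)
    from e(1) obtain x y where xy: "e = {x, y}" using core_simple unfolding simple_graph_def by blast
    have "{s, t} = {Inl x, Inl y}" using e(2) by (simp add: xy)
    then consider "s = Inl x" "t = Inl y" | "s = Inl y" "t = Inl x"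
      unfolding doubleton_eq_iff by blast
    then show ?R
    proof cases
      case 1
      with e(1) show ?thesis unfolding adj_def xy by blast
    next
      case 2
      with e(1) show ?thesis unfolding adj_def xy by (metis insert_commute)
    qed
  next
    assume ?R
    then obtain x y where "s = Inl x" "t = Inl y" "{x, y} \<in> edges (core2 G)" unfolding adj_def by blast
    then show ?L by (intro image_eqI[of _ _ "{x, y}"]) simp_all
  qed
  moreover have "{s, t} \<in> (\<lambda>x. {Inl x, Inr x}) ` attach_set G
      \<longleftrightarrow> (\<exists>x\<in>attach_set G. s = Inl x \<and> t = Inr x \<or> s = Inr x \<and> t = Inl x)"
    unfolding image_iff doubleton_eq_iff ..
  moreover have "edges P = (\<lambda>e. Inl ` e) ` edges (core2 G) \<union> (\<lambda>x. {Inl x, Inr x}) ` attach_set G"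
    by (simp add: pendant_core_def)
  ultimately show ?thesis by (simp only: adj_def[of P] Un_iff)
qed

lemma pendant_core_simple: "simple_graph P"
  unfolding simple_graph_def
proof
  fix e assume "e \<in> edges P"
  then consider f where "f \<in> edges (core2 G)" "e = Inl ` f"
    | x where "x \<in> attach_set G" "e = {Inl x, Inr x}"
    by (auto simp: pendant_core_def)
  then show "\<exists>s t. s \<in> verts P \<and> t \<in> verts P \<and> s \<noteq> t \<and> e = {s, t}"
  proof cases
    case 1
    then obtain x y where "x \<in> K" "y \<in> K" "x \<noteq> y" "f = {x, y}"
      using core_simple unfolding simple_graph_def by blast
    with 1 show ?thesis by (intro exI[of _ "Inl x"] exI[of _ "Inl y"]) (auto simp: pendant_core_def)
  next
    case 2
    then show ?thesis
      by (intro exI[of _ "Inl x"] exI[of _ "Inr x"]) (auto simp: pendant_core_def attach_core)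
  qed
qed

lemma pendant_core_finite: "finite (verts P)"
  using core_fin by (auto simp: pendant_core_def attach_set_def)

text \<open>All tree vertices hanging off \<open>x\<close> go to the single vertex
  \<open>Inr x\<close>, whatever their depth, so edges inside a tree are contracted.\<close>

definition collapse :: "'a \<Rightarrow> 'a + 'a" where
  "collapse v = (if v \<in> K then Inl v else Inr (root v))"

lemma collapse_parent:
  assumes "v \<in> verts G" "v \<notin> K"
  shows "adj P (collapse v) (collapse (parent v)) \<or> collapse v = collapse (parent v)"
proof (cases "parent v \<in> K")
  case True
  have "adj G (parent v) v" using parent(1)[OF assms] by (simp add: adj_sym)
  from root_nbr(2,3)[OF True this assms(2)] show ?thesis
    using True assms by (simp add: collapse_def adj_pendant_core)
next
  case False
  then show ?thesis using assms by (simp add: collapse_def root_parent)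
qed

lemma collapse_hom:
  assumes "adj G a b"
  shows "adj P (collapse a) (collapse b) \<or> collapse a = collapse b"
  using assms
proof (cases rule: adj_cases)
  case core
  then show ?thesis by (simp add: collapse_def adj_pendant_core)
next
  case child
  then show ?thesis using collapse_parent[of a] adjD[OF simple assms] by blast
next
  case parent
  then show ?thesis using collapse_parent[of b] adjD[OF simple assms] by (auto simp: adj_sym)
qed

lemma collapse_nbr: "x \<in> K \<Longrightarrow> adj G x u \<Longrightarrow> u \<notin> K \<Longrightarrow> collapse u = Inr x"
  by (simp add: collapse_def root_nbr)

text \<open>\<open>collapse\<close> does not increase distances, and a homomorphism
  \<open>\<psi>\<close> back into \<open>G\<close> with \<open>\<psi> (collapse u) = u\<close> and
  \<open>\<psi> (collapse v) = v\<close> gives the reverse inequality.\<close>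

lemma gdist_collapse:
  assumes xy: "x \<in> K" "y \<in> K" "x \<noteq> y"
    and u: "u \<in> insert x (nbrs G x)" and v: "v \<in> insert y (nbrs G y)"
  shows "gdist P (collapse u) (collapse v) = gdist G u v"
proof -
  have V: "u \<in> verts G" "v \<in> verts G"
    using xy u v core_sub adjD[OF simple] by (auto simp: nbrs_def)
  note le = gdist_map_le[where f = collapse, OF reach[OF V] collapse_hom]
  \<comment> \<open>The way back depends on \<open>u\<close> and \<open>v\<close>: the pendant
    vertices of \<open>x\<close> and \<open>y\<close> return to \<open>u\<close> and
    \<open>v\<close> if these are tree vertices, and every other one to an arbitrary tree neighbour.
    The two choices do not clash because \<open>x \<noteq> y\<close>.\<close>
  define g where "g = (\<lambda>k. if k = x \<and> u \<notin> K then u else if k = y \<and> v \<notin> K then v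
    else SOME z. adj G k z \<and> z \<notin> K)"
  define \<psi> where "\<psi> = case_sum (\<lambda>k. k) g"
  have g: "adj G k (g k)" if "k \<in> attach_set G" for k
    using someI_ex[OF attach_nbr[OF that]] u v xy by (auto simp: g_def nbrs_def)
  have hom: "adj G (\<psi> s) (\<psi> t)" if "adj P s t" for s t
    using that by (auto simp: adj_pendant_core \<psi>_def core_adj g adj_sym)
  have "\<psi> (collapse u) = u"
  proof (cases "u \<in> K")
    case False
    then have "collapse u = Inr x" using u xy by (intro collapse_nbr) (auto simp: nbrs_def)
    with False show ?thesis by (simp add: \<psi>_def g_def)
  qed (simp add: collapse_def \<psi>_def)
  moreover have "\<psi> (collapse v) = v"
  proof (cases "v \<in> K")
    case False
    then have "collapse v = Inr y" using v xy by (intro collapse_nbr) (auto simp: nbrs_def)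
    with False xy show ?thesis by (simp add: \<psi>_def g_def)
  qed (simp add: collapse_def \<psi>_def)
  moreover have "gdist G (\<psi> (collapse u)) (\<psi> (collapse v)) \<le> gdist P (collapse u) (collapse v)"
    by (rule gdist_map_le(1)[where f = \<psi>, OF le(2)]) (simp_all add: hom)
  ultimately show ?thesis using le(1) by simp
qed

section \<open>Matching weights give equal curvature on core edges\<close>

definition matching_weights :: "('a set \<Rightarrow> real) \<Rightarrow> (('a + 'a) set \<Rightarrow> real) \<Rightarrow> bool" where
  "matching_weights w w' \<longleftrightarrow> (\<forall>e\<in>edges (core2 G). w' (Inl ` e) = w e)
    \<and> (\<forall>x\<in>attach_set G. w' {Inl x, Inr x} = (\<Sum>u\<in>nbrs G x - K. w {x, u}))"

text \<open>\<open>collapse\<close> is constant on the tree neighbours of \<open>x\<close>, so their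
  weights add up to that of the pendant edge. With \<open>g = 1\<close> this compares weighted
  degrees, with an indicator it compares the walks.\<close>

lemma sum_nbrs_collapse:
  fixes g :: "'a + 'a \<Rightarrow> real"
  assumes "matching_weights w w'" "x \<in> K"
  shows "(\<Sum>t\<in>nbrs P (Inl x). w' {Inl x, t} * g t) = (\<Sum>z\<in>nbrs G x. w {x, z} * g (collapse z))"
proof -
  let ?C = "nbrs (core2 G) x" and ?N = "nbrs G x - K"
  have CK: "?C = nbrs G x \<inter> K"
    using core_induced[OF assms(2)] core_adj adjD[OF core_simple] by (auto simp: nbrs_def)
  have finN: "finite (nbrs G x)" by (rule finite_nbrs[OF simple fin])
  have nP: "nbrs P (Inl x) = Inl ` ?C \<union> (if x \<in> attach_set G then {Inr x} else {})"
    by (auto simp: nbrs_def adj_pendant_core)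
  have wC: "w' {Inl x, Inl z} = w {x, z}" if "z \<in> ?C" for z
  proof -
    have "{x, z} \<in> edges (core2 G)" using that by (simp add: nbrs_def adj_def)
    with assms(1) have "w' (Inl ` {x, z}) = w {x, z}" unfolding matching_weights_def by blast
    then show ?thesis by simp
  qed
  have "(\<Sum>t\<in>Inl ` ?C. w' {Inl x, t} * g t) = (\<Sum>z\<in>?C. w {x, z} * g (collapse z))"
    by (subst sum.reindex) (auto simp: wC CK collapse_def intro!: sum.cong)
  moreover have "(\<Sum>t\<in>(if x \<in> attach_set G then {Inr x} else {}). w' {Inl x, t} * g t)
      = (\<Sum>z\<in>?N. w {x, z} * g (collapse z))"
  proof (cases "x \<in> attach_set G")
    case True
    have "(\<Sum>z\<in>?N. w {x, z} * g (collapse z)) = (\<Sum>z\<in>?N. w {x, z} * g (Inr x))"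
      by (rule sum.cong) (use collapse_nbr[OF assms(2)] in \<open>auto simp: nbrs_def\<close>)
    then show ?thesis using True assms(1) by (simp add: matching_weights_def sum_distrib_right)
  next
    case False
    then have N: "?N = {}" using root_nbr(3)[OF assms(2)] by (auto simp: nbrs_def)
    show ?thesis unfolding N using False by simp
  qed
  moreover have "(\<Sum>z\<in>nbrs G x. w {x, z} * g (collapse z))
      = (\<Sum>z\<in>?C. w {x, z} * g (collapse z)) + (\<Sum>z\<in>?N. w {x, z} * g (collapse z))"
    unfolding CK using finN by (rule sum.Int_Diff)
  ultimately show ?thesis
    unfolding nP using finN CK by (subst sum.union_disjoint) auto
qed

lemma map_collapse_lazy_walk:
  assumes m: "matching_weights w w'" and w: "positive_weight G w" "positive_weight P w'"
    and xy: "adj (core2 G) x y" and \<alpha>: "0 \<le> \<alpha>" "\<alpha> \<le> 1"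
  shows "map_pmf collapse (lazy_walk G w \<alpha> x) = lazy_walk P w' \<alpha> (Inl x)"
proof (rule pmf_eqI)
  fix b
  have x: "x \<in> K" using adjD[OF core_simple xy] by simp
  have xyP: "adj P (Inl x) (Inl y)" using xy by (simp add: adj_pendant_core)
  have deg: "wdeg P w' (Inl x) = wdeg G w x"
    using sum_nbrs_collapse[OF m x, of "\<lambda>_. 1"] by (simp add: wdeg_def)
  \<comment> \<open>A point mass is written as the expectation of an indicator, so that both sides
    become neighbour sums.\<close>
  have "pmf (map_pmf collapse (lazy_walk G w \<alpha> x)) b
      = measure_pmf.expectation (lazy_walk G w \<alpha> x) (\<lambda>z. indicator {b} (collapse z))"
    by (simp add: pmf_map indicator_vimage[symmetric] measure_pmf.emeasure_eq_measure flip: comp_def)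
  also have "\<dots> = measure_pmf.expectation (lazy_walk P w' \<alpha> (Inl x)) (indicator {b})"
    unfolding expectation_lazy_walk[OF simple fin w(1) core_adj[OF xy] \<alpha>]
      expectation_lazy_walk[OF pendant_core_simple pendant_core_finite w(2) xyP \<alpha>]
      sum_nbrs_collapse[OF m x] deg
    using x by (simp add: collapse_def)
  also have "\<dots> = pmf (lazy_walk P w' \<alpha> (Inl x)) b"
    by (simp add: measure_pmf_single)
  finally show "pmf (map_pmf collapse (lazy_walk G w \<alpha> x)) b = pmf (lazy_walk P w' \<alpha> (Inl x)) b" .
qed

text \<open>\<open>collapse\<close> pushes the lazy walks at \<open>x\<close> and \<open>y\<close>
  forward to those at \<open>Inl x\<close> and \<open>Inl y\<close> and preserves distances between
  their supports, so even the curvatures for fixed \<open>\<alpha>\<close> agree.\<close>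

lemma kappa_LLY_collapse:
  assumes m: "matching_weights w w'" and w: "positive_weight G w" "positive_weight P w'"
    and xy: "adj (core2 G) x y"
  shows "kappa_LLY P w' (Inl x) (Inl y) = kappa_LLY G w x y"
proof -
  have K: "x \<in> K" "y \<in> K" "x \<noteq> y" using adjD[OF core_simple xy] by auto
  have yx: "adj (core2 G) y x" using xy by (simp add: adj_sym)
  have "kappa P w' \<alpha> (Inl x) (Inl y) = kappa G w \<alpha> x y" if \<alpha>: "0 \<le> \<alpha>" "\<alpha> \<le> 1" for \<alpha>
    unfolding kappa_def map_collapse_lazy_walk[OF m w xy \<alpha>, symmetric]
      map_collapse_lazy_walk[OF m w yx \<alpha>, symmetric]
  proof (subst wasserstein1_map_pmf)
    fix u v assume "u \<in> set_pmf (lazy_walk G w \<alpha> x)" "v \<in> set_pmf (lazy_walk G w \<alpha> y)"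
    then show "real (gdist P (collapse u) (collapse v)) = real (gdist G u v)"
      using set_lazy_walk[OF simple fin w(1) core_adj[OF xy] \<alpha>]
        set_lazy_walk[OF simple fin w(1) core_adj[OF yx] \<alpha>]
        gdist_collapse[OF K, of u v] by auto
  qed simp
  moreover have "eventually (\<lambda>\<alpha>. \<alpha> \<in> {0<..<1}) (at_left (1::real))"
    by (rule eventually_at_left_real) auto
  ultimately have "eventually (\<lambda>\<alpha>. kappa P w' \<alpha> (Inl x) (Inl y) / (1 - \<alpha>)
      = kappa G w \<alpha> x y / (1 - \<alpha>)) (at_left 1)"
    by (auto elim!: eventually_mono)
  \<comment> \<open>The quotients coincide near 1, so the two \<open>Lim\<close> terms are equal
    whether or not the limit exists.\<close>
  then show ?thesis
    unfolding kappa_LLY_def by (rule Lim_cong) simp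
qed

end

section \<open>Existence of admissible weights\<close>

text \<open>On a finite nonempty edge set the supremum and infimum are attained at positive weights,
  so every admissible weight has finite distortion. An edge has two endpoints, which rules out the
  one-vertex convention.\<close>

lemma DN_LLY_finite_iff:
  assumes G: "simple_graph G" "finite (verts G)" and e: "edges G \<noteq> {}"
  shows "DN_LLY G < \<infinity> \<longleftrightarrow> (\<exists>w. admissible G w)"
proof -
  have sub: "edges G \<subseteq> Pow (verts G)"
  proof
    fix f assume "f \<in> edges G"
    then obtain x y where "x \<in> verts G" "y \<in> verts G" "f = {x, y}"
      using G(1) unfolding simple_graph_def by blast
    then show "f \<in> Pow (verts G)" by simp
  qed
  have fin: "finite (edges G)" by (rule finite_subset[OF sub]) (simp add: G(2))
  obtain f where "f \<in> edges G" using e by blast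
  then obtain x y where xy: "x \<in> verts G" "y \<in> verts G" "x \<noteq> y"
    using G(1) unfolding simple_graph_def by blast
  then have "\<nexists>x. verts G = {x}" by (metis singletonD)
  then have DN: "DN_LLY G = (INF w\<in>{w. admissible G w}. distortion G w)"
    unfolding DN_LLY_def by (simp only: if_False)
  have "distortion G w < \<infinity>" if "admissible G w" for w
  proof -
    let ?X = "(\<lambda>e. ereal (w e)) ` edges G"
    have X: "finite ?X" "?X \<noteq> {}" using fin e by auto
    have "Sup ?X \<in> ?X" "Inf ?X \<in> ?X"
      using Max_in[OF X] Min_in[OF X] cSup_eq_Max[OF X] cInf_eq_Min[OF X] by metis+
    then obtain e1 e2 where S: "Sup ?X = ereal (w e1)" and I: "Inf ?X = ereal (w e2)" "e2 \<in> edges G"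
      by blast
    have "0 < w e2" using that I(2) by (simp add: admissible_def positive_weight_def)
    then show ?thesis unfolding distortion_def Let_def S I(1) by (simp add: ereal_divide)
  qed
  then show ?thesis unfolding DN INF_less_iff by blast
qed

text \<open>Admissibility ranges over ordered pairs, so both orientations are wanted; the complement
  of \<open>T\<close> is the cut for the reversed edge.\<close>

lemma kappa_LLY_bridge_nonneg:
  assumes G: "simple_graph G" "finite (verts G)" and w: "positive_weight G w"
    and xy: "adj G x y" "y \<in> T" "x \<notin> T"
    and cut: "\<And>a b. adj G a b \<Longrightarrow> a \<in> T \<Longrightarrow> b \<notin> T \<Longrightarrow> a = y \<and> b = x"
    and le: "1 \<le> w {x, y} / wdeg G w x + w {x, y} / wdeg G w y"
  shows "0 \<le> kappa_LLY G w x y" "0 \<le> kappa_LLY G w y x"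
proof -
  show "0 \<le> kappa_LLY G w x y"
    using kappa_LLY_bridge[OF G w xy cut] le by simp
  have "kappa_LLY G w y x = 2 * (w {y, x} / wdeg G w y + w {y, x} / wdeg G w x) - 2"
  proof (rule kappa_LLY_bridge[OF G w, where T = "- T"])
    show "adj G y x" using xy(1) by (simp add: adj_sym)
    show "x \<in> - T" "y \<notin> - T" using xy by auto
    show "a = x \<and> b = y" if "adj G a b" "a \<in> - T" "b \<notin> - T" for a b
      using cut[of b a] that by (simp add: adj_sym)
  qed
  then show "0 \<le> kappa_LLY G w y x" using le by (simp add: insert_commute)
qed

text \<open>The claim amounts to \<open>(d - a) * (d' - a) \<le> a * a\<close>, and
  \<open>d - a\<close> is at most \<open>d\<close>. In the application \<open>a\<close> is the
  weight of the edge from a tree vertex to its parent, \<open>d\<close> the degree of the parent,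
  and \<open>d' - a\<close> the total weight towards the children.\<close>

lemma one_le_bridge_ratios:
  fixes a d d' :: real
  assumes "0 < a" "0 < d" "a \<le> d'" "(d' - a) * d \<le> a * a"
  shows "1 \<le> a / d + a / d'"
proof -
  have "a * a \<le> a * d'" using assms by simp
  with assms(4) have "d * d' \<le> a * d' + a * d" by (simp add: algebra_simps)
  then show ?thesis using assms by (simp add: field_simps)
qed

text \<open>Inserting \<open>c\<close> or 1 covers an empty \<open>S\<close>, which occurs when no
  tree is attached to the core.\<close>

lemma finite_bounds:
  fixes f :: "'a \<Rightarrow> real"
  assumes "finite S"
  shows "\<exists>B\<ge>c. \<forall>x\<in>S. f x \<le> B"
    and "(\<And>x. x \<in> S \<Longrightarrow> 0 < f x) \<Longrightarrow> \<exists>a>0. \<forall>x\<in>S. a \<le> f x"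
proof -
  show "\<exists>B\<ge>c. \<forall>x\<in>S. f x \<le> B"
    by (rule exI[of _ "Max (insert c (f ` S))"]) (use assms in auto)
  show "\<exists>a>0. \<forall>x\<in>S. a \<le> f x" if "\<And>x. x \<in> S \<Longrightarrow> 0 < f x"
    by (rule exI[of _ "Min (insert 1 (f ` S))"]) (use assms that in auto)
qed

section \<open>Carrying admissible weights between the two graphs\<close>

context core_graph
begin

lemma core_edge_ex: "\<exists>x y. adj (core2 G) x y"
proof -
  obtain x where "x \<in> K" using core_ne by blast
  with core_deg have "nbrs (core2 G) x \<noteq> {}" by fastforce
  then show ?thesis by (auto simp: nbrs_def)
qed

lemma DN_LLY_iff: "DN_LLY G < \<infinity> \<longleftrightarrow> (\<exists>w. admissible G w)"
proof (rule DN_LLY_finite_iff[OF simple fin])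
  from core_edge_ex obtain x y where "adj G x y" using core_adj by blast
  then show "edges G \<noteq> {}" by (auto simp: adj_def)
qed

lemma DN_LLY_pendant_core_iff: "DN_LLY P < \<infinity> \<longleftrightarrow> (\<exists>w. admissible P w)"
proof (rule DN_LLY_finite_iff[OF pendant_core_simple pendant_core_finite])
  from core_edge_ex show "edges P \<noteq> {}" by (auto simp: pendant_core_def adj_def)
qed

lemma edge_adj:
  assumes "e \<in> edges G"
  obtains x y where "adj G x y" "e = {x, y}"
proof -
  from assms obtain x y where "e = {x, y}" using simple unfolding simple_graph_def by blast
  with assms that show thesis by (simp add: adj_def)
qed

lemma core_edges_sub: "edges (core2 G) \<subseteq> edges G"
  using core2 unfolding is_core2_def subgraph_def by blast

text \<open>A pendant edge is a bridge whose weight is the whole degree of its pendant end, so that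
  ratio alone is already 1.\<close>

lemma kappa_LLY_pendant_nonneg:
  assumes w: "positive_weight P w" and x: "x \<in> attach_set G"
  shows "0 \<le> kappa_LLY P w (Inl x) (Inr x)" "0 \<le> kappa_LLY P w (Inr x) (Inl x)"
proof -
  have adj: "adj P (Inl x) (Inr x)" using x by (simp add: adj_pendant_core)
  then have "adj P (Inr x) (Inl x)" by (simp add: adj_sym)
  note deg = wdeg_pos[OF pendant_core_simple pendant_core_finite w adj]
    wdeg_pos[OF pendant_core_simple pendant_core_finite w this]
  have "nbrs P (Inr x) = {Inl x}" using x by (auto simp: nbrs_def adj_pendant_core)
  then have "wdeg P w (Inr x) = w {Inl x, Inr x}" by (simp add: wdeg_def insert_commute)
  then have le: "1 \<le> w {Inl x, Inr x} / wdeg P w (Inl x) + w {Inl x, Inr x} / wdeg P w (Inr x)"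
    using deg by simp
  have cut: "a = Inr x \<and> b = Inl x" if "adj P a b" "a \<in> {Inr x}" "b \<notin> {Inr x}" for a b
    using that by (auto simp: adj_pendant_core)
  show "0 \<le> kappa_LLY P w (Inl x) (Inr x)" "0 \<le> kappa_LLY P w (Inr x) (Inl x)"
    using kappa_LLY_bridge_nonneg[OF pendant_core_simple pendant_core_finite w adj _ _ cut le] by auto
qed

lemma admissible_pendant_core:
  assumes "admissible G w"
  shows "\<exists>w'. admissible P w'"
proof -
  have w: "positive_weight G w" using assms by (simp add: admissible_def)
  \<comment> \<open>Weights are functions of edges as sets: a pendant edge is recognised by its
    nonempty \<open>Inr\<close> preimage, whose single element is the core vertex.\<close>
  define w' where "w' = (\<lambda>s :: ('a + 'a) set. if Inr -` s = {} then w (Inl -` s)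
    else \<Sum>u\<in>nbrs G (the_elem (Inr -` s)) - K. w {the_elem (Inr -` s), u})"
  have w'_core: "w' (Inl ` e) = w e" for e
  proof -
    have "Inr -` (Inl ` e :: ('a + 'a) set) = {}" "Inl -` (Inl ` e :: ('a + 'a) set) = e" by auto
    then show ?thesis by (simp add: w'_def)
  qed
  have w'_pend: "w' {Inl x, Inr x} = (\<Sum>u\<in>nbrs G x - K. w {x, u})" for x
  proof -
    have "Inr -` {Inl x :: 'a + 'a, Inr x} = {x}" by auto
    then show ?thesis by (simp add: w'_def)
  qed
  have m: "matching_weights w w'" by (simp add: matching_weights_def w'_core w'_pend)
  have pos: "positive_weight P w'"
    unfolding positive_weight_def
  proof
    fix s assume "s \<in> edges P"
    then consider e where "e \<in> edges (core2 G)" "s = Inl ` e"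
      | x where "x \<in> attach_set G" "s = {Inl x, Inr x}"
      by (auto simp: pendant_core_def)
    then show "0 < w' s"
    proof cases
      case 1
      then show ?thesis using w core_edges_sub by (auto simp: w'_core positive_weight_def)
    next
      case 2
      have "0 < (\<Sum>u\<in>nbrs G x - K. w {x, u})"
        by (rule sum_pos) (use attach_nbr[OF 2(1)] finite_nbrs[OF simple fin] w
            in \<open>auto simp: nbrs_def adj_def positive_weight_def\<close>)
      then show ?thesis by (simp add: 2 w'_pend)
    qed
  qed
  have "0 \<le> kappa_LLY P w' s t" if "adj P s t" for s t
  proof -
    from that consider x y where "s = Inl x" "t = Inl y" "adj (core2 G) x y"
      | x where "x \<in> attach_set G" "s = Inl x" "t = Inr x"
      | x where "x \<in> attach_set G" "s = Inr x" "t = Inl x"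
      by (auto simp: adj_pendant_core)
    then show ?thesis
    proof cases
      case 1
      then show ?thesis
        using kappa_LLY_collapse[OF m w pos] core_adj assms by (auto simp: admissible_def)
    qed (use kappa_LLY_pendant_nonneg[OF pos] in auto)
  qed
  with pos show ?thesis by (auto simp: admissible_def)
qed

lemma parent_cases:
  assumes "v \<in> verts G" "v \<notin> K"
  obtains "parent v \<in> K" "height v = 1" "parent v \<in> attach_set G"
  | k where "parent v \<in> verts G" "parent v \<notin> K" "height (parent v) = Suc k" "height v = Suc (Suc k)"
proof (cases "parent v \<in> K")
  case True
  have "adj G (parent v) v" using parent(1)[OF assms] by (simp add: adj_sym)
  with True show thesis
    using that(1) root_nbr(3)[OF True _ assms(2)] parent(2)[OF assms] by (simp add: height_core)
next
  case False
  have V: "parent v \<in> verts G" using parent(1)[OF assms] adjD[OF simple] by blast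
  show thesis
    using that(2)[OF V False] parent(2)[OF assms] parent(2)[OF V False] by simp
qed

text \<open>The weights decay superexponentially in the height, so that the children of a tree vertex
  weigh little even in comparison with the share of its own edge at its parent.\<close>

lemma admissible_if_pendant_core:
  assumes "admissible P w'"
  shows "\<exists>w. admissible G w"
proof -
  have pos': "positive_weight P w'" using assms by (simp add: admissible_def)
  note finN = finite_nbrs[OF simple fin]
  define n where "n = real (card (verts G))"
  \<comment> \<open>The pendant weight at \<open>x\<close> is shared equally among the tree edges at
    \<open>x\<close>.\<close>
  define g where "g = (\<lambda>x. w' {Inl x, Inr x} / real (card (nbrs G x - K)))"
  have card_pos: "0 < card (nbrs G x - K)" if "x \<in> attach_set G" for x
    using attach_nbr[OF that] finN by (auto simp: card_gt_0_iff nbrs_def)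
  have g_pos: "0 < g x" if "x \<in> attach_set G" for x
    using pos' that card_pos[OF that] by (auto simp: g_def positive_weight_def pendant_core_def)
  have fin_attach: "finite (attach_set G)" using core_fin by (simp add: attach_set_def)
  obtain a0 where a0: "0 < a0" "\<And>x. x \<in> attach_set G \<Longrightarrow> a0 \<le> g x"
    using finite_bounds(2)[of "attach_set G" g, OF fin_attach g_pos] by blast
  obtain B0 where B0: "1 \<le> B0" "\<And>x. x \<in> attach_set G \<Longrightarrow> g x \<le> B0"
    using finite_bounds(1)[OF fin_attach, of 1 g] by blast
  obtain B where B: "B0 \<le> B" "\<And>x. x \<in> K \<Longrightarrow> wdeg P w' (Inl x) \<le> B"
    using finite_bounds(1)[OF core_fin, of B0 "\<lambda>x. wdeg P w' (Inl x)"] by blast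
  have n: "1 \<le> n"
    using core_sub core_ne fin by (auto simp: n_def card_gt_0_iff Suc_le_eq)
  have nB: "0 < n * (B + n)" "0 < n * B" using n B(1) B0(1) by (auto intro!: mult_pos_pos)
  \<comment> \<open>The bound \<open>1 / (n * (B + n))\<close> serves tree vertices of height at
    least 2, and \<open>a0 * a0 / (n * B)\<close> those of height 1. The bound 1 makes powers of
    \<open>\<epsilon>\<close> decreasing in the exponent.\<close>
  define \<epsilon> where "\<epsilon> = min 1 (min (1 / (n * (B + n))) (a0 * a0 / (n * B)))"
  have \<epsilon>: "0 < \<epsilon>" "\<epsilon> \<le> 1" "n * (B + n) * \<epsilon> \<le> 1" "n * B * \<epsilon> \<le> a0 * a0"
  proof -
    show "0 < \<epsilon>" "\<epsilon> \<le> 1" using nB a0(1) by (auto simp: \<epsilon>_def)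
    have "\<epsilon> \<le> 1 / (n * (B + n))" "\<epsilon> \<le> a0 * a0 / (n * B)" by (auto simp: \<epsilon>_def)
    then show "n * (B + n) * \<epsilon> \<le> 1" "n * B * \<epsilon> \<le> a0 * a0"
      using nB by (simp_all add: pos_le_divide_eq mult.commute)
  qed
  \<comment> \<open>The cases are edges with two, no and one endpoint in the core. In the second the
    larger height is that of the child, and its square is the exponent.\<close>
  define w where "w = (\<lambda>e. if e \<subseteq> K then w' (Inl ` e)
    else if e \<inter> K = {} then \<epsilon> ^ (Max (height ` e))\<^sup>2 else g (the_elem (e \<inter> K)))"
  have w_core: "w e = w' (Inl ` e)" if "e \<in> edges (core2 G)" for e
    using that core_simple by (auto simp: w_def simple_graph_def)
  have w_attach: "w {x, u} = g x" if "x \<in> K" "u \<notin> K" for x u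
  proof -
    have "{x, u} \<inter> K = {x}" using that by auto
    then show ?thesis using that by (simp add: w_def)
  qed
  have w_tree: "w {v, parent v} = \<epsilon> ^ (height v)\<^sup>2" if "v \<in> verts G" "v \<notin> K" "parent v \<notin> K" for v
    using that parent(2)[OF that(1,2)] by (simp add: w_def max_def)
  have m: "matching_weights w w'"
    unfolding matching_weights_def
  proof (intro conjI ballI)
    fix x assume x: "x \<in> attach_set G"
    have "(\<Sum>u\<in>nbrs G x - K. w {x, u}) = (\<Sum>u\<in>nbrs G x - K. g x)"
      by (rule sum.cong) (auto simp: w_attach attach_core[OF x])
    then show "w' {Inl x, Inr x} = (\<Sum>u\<in>nbrs G x - K. w {x, u})"
      using card_pos[OF x] by (simp add: g_def)
  qed (simp add: w_core)
  have tree_pos: "0 < w {v, parent v}" if "v \<in> verts G" "v \<notin> K" for v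
  proof (cases "parent v \<in> K")
    case True
    then show ?thesis using that g_pos w_attach[of "parent v" v]
      by (cases rule: parent_cases[OF that]) (auto simp: insert_commute)
  qed (use that w_tree \<epsilon> in simp)
  have adj_pos: "0 < w {u, v}" if "adj G u v" for u v
    using that
  proof (cases rule: adj_cases)
    case core
    then have "{u, v} \<in> edges (core2 G)" by (simp add: adj_def)
    have "adj P (Inl u) (Inl v)" using core by (simp add: adj_pendant_core)
    with pos' have "0 < w' {Inl u, Inl v}" by (simp add: positive_weight_def adj_def)
    with w_core[OF \<open>{u, v} \<in> edges (core2 G)\<close>] show ?thesis by simp
  next
    case child
    then show ?thesis using tree_pos[of u] adjD[OF simple that] by simp
  next
    case parent
    then show ?thesis using tree_pos[of v] adjD[OF simple that] by (simp add: insert_commute)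
  qed
  have pos: "positive_weight G w"
    unfolding positive_weight_def using edge_adj adj_pos by metis
  \<comment> \<open>As \<open>v\<close> is outside the core, the edges to its children lie inside
    the tree, all have the same weight, and number at most \<open>n\<close>.\<close>
  have deg: "w {v, parent v} \<le> wdeg G w v"
      "wdeg G w v - w {v, parent v} \<le> n * \<epsilon> ^ (Suc (height v))\<^sup>2"
    if v: "v \<in> verts G" "v \<notin> K" for v
  proof -
    let ?C = "nbrs G v - {parent v}"
    have "parent v \<in> nbrs G v" using parent(1)[OF v] by (simp add: nbrs_def)
    then have "wdeg G w v = w {v, parent v} + (\<Sum>c\<in>?C. w {v, c})"
      unfolding wdeg_def using finN by (simp add: sum.remove)
    also have "(\<Sum>c\<in>?C. w {v, c}) = (\<Sum>c\<in>?C. \<epsilon> ^ (Suc (height v))\<^sup>2)"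
    proof (rule sum.cong)
      fix c assume c: "c \<in> ?C"
      then have vc: "adj G v c" by (simp add: nbrs_def)
      then have "c \<notin> K \<and> v = parent c" by (cases rule: adj_cases) (use c v in auto)
      then show "w {v, c} = \<epsilon> ^ (Suc (height v))\<^sup>2"
        using w_tree[of c] v parent(2)[of c] adjD[OF simple vc] by (simp add: insert_commute)
    qed simp
    also have "\<dots> = real (card ?C) * \<epsilon> ^ (Suc (height v))\<^sup>2" by simp
    finally have eq: "wdeg G w v = w {v, parent v} + real (card ?C) * \<epsilon> ^ (Suc (height v))\<^sup>2" .
    have "nbrs G v \<subseteq> verts G" using adjD[OF simple] by (auto simp: nbrs_def)
    then have "card ?C \<le> card (verts G)" using fin by (intro card_mono) auto
    then have "real (card ?C) \<le> n" by (simp add: n_def)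
    with eq \<epsilon>(1) show "w {v, parent v} \<le> wdeg G w v"
      "wdeg G w v - w {v, parent v} \<le> n * \<epsilon> ^ (Suc (height v))\<^sup>2"
      by (auto intro: mult_right_mono)
  qed
  have deg_core: "wdeg G w x \<le> B" if "x \<in> K" for x
    using sum_nbrs_collapse[OF m that, of "\<lambda>_. 1"] B(2)[OF that] by (simp add: wdeg_def)
  have ratio: "1 \<le> w {parent v, v} / wdeg G w (parent v) + w {parent v, v} / wdeg G w v"
    if v: "v \<in> verts G" "v \<notin> K" for v
    unfolding insert_commute[of "parent v" v]
  proof (rule one_le_bridge_ratios[OF tree_pos[OF v] _ deg(1)[OF v]])
    have "adj G (parent v) v" using parent(1)[OF v] by (simp add: adj_sym)
    then show d: "0 < wdeg G w (parent v)" by (rule wdeg_pos[OF simple fin pos])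
    from v show "(wdeg G w v - w {v, parent v}) * wdeg G w (parent v) \<le> w {v, parent v} * w {v, parent v}"
    proof (cases rule: parent_cases)
      case 1
      \<comment> \<open>Here \<open>v\<close> has height 1: its edge weighs at least
        \<open>a0\<close>, while its children have height 2 and weigh \<open>\<epsilon> ^ 4\<close>
        each.\<close>
      have sq: "(Suc (height v))\<^sup>2 = 4" by (simp add: 1(2) power2_eq_square)
      have "(wdeg G w v - w {v, parent v}) * wdeg G w (parent v) \<le> (n * \<epsilon> ^ 4) * B"
        using deg(1)[OF v] deg(2)[OF v, unfolded sq] deg_core[OF 1(1)] d n \<epsilon>(1)
        by (intro mult_mono) auto
      also have "\<dots> = n * B * \<epsilon> * \<epsilon> ^ 3" by (simp add: power_def numeral_eq_Suc)
      also have "\<dots> \<le> n * B * \<epsilon>"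
        using nB \<epsilon> by (intro mult_left_le) (auto intro: power_le_one)
      also have "\<dots> \<le> a0 * a0" by (rule \<epsilon>(4))
      also have "\<dots> \<le> g (parent v) * g (parent v)"
        using a0 1(3) by (intro mult_mono) (auto intro: order_trans[OF less_imp_le])
      also have "\<dots> = w {v, parent v} * w {v, parent v}"
        using w_attach[OF 1(1) v(2)] by (simp add: insert_commute)
      finally show ?thesis .
    next
      case (2 k)
      let ?u = "parent v"
      \<comment> \<open>The exponent is \<open>(k + 1)\<^sup>2 - 1\<close>. It vanishes for
        \<open>k = 0\<close>, where the edge from the parent leads into the core and is only known
        to weigh at most \<open>B\<close>.\<close>
      have up: "w {?u, parent ?u} \<le> B * \<epsilon> ^ (k * (k + 2))"
      proof (cases rule: parent_cases[OF 2(1,2)])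
        case 1
        then show ?thesis
          using w_attach[OF 1(1) 2(2)] B0(2)[OF 1(3)] B(1) 2(3) by (simp add: insert_commute)
      next
        case (2 j)
        have "w {?u, parent ?u} = \<epsilon> ^ (Suc k)\<^sup>2"
          using w_tree[OF \<open>?u \<in> verts G\<close> \<open>?u \<notin> K\<close> 2(2)] \<open>height ?u = Suc k\<close> by simp
        also have "\<dots> \<le> \<epsilon> ^ (k * (k + 2))"
          using \<epsilon> by (intro power_decreasing) (auto simp: power2_eq_square)
        also have "\<dots> \<le> B * \<epsilon> ^ (k * (k + 2))" using B(1) B0(1) \<epsilon>(1) by simp
        finally show ?thesis .
      qed
      have "\<epsilon> ^ (Suc (Suc k))\<^sup>2 \<le> \<epsilon> ^ (k * (k + 2))"
        using \<epsilon> by (intro power_decreasing) (auto simp: power2_eq_square)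
      then have "n * \<epsilon> ^ (Suc (Suc k))\<^sup>2 \<le> n * \<epsilon> ^ (k * (k + 2))"
        using n by (intro mult_left_mono) auto
      with up deg(2)[OF 2(1,2)] 2(3) have du: "wdeg G w ?u \<le> (B + n) * \<epsilon> ^ (k * (k + 2))"
        by (simp add: algebra_simps)
      have "(wdeg G w v - w {v, ?u}) * wdeg G w ?u
          \<le> (n * \<epsilon> ^ (Suc (Suc (Suc k)))\<^sup>2) * ((B + n) * \<epsilon> ^ (k * (k + 2)))"
        using deg(1,2)[OF v] du d n \<epsilon>(1) 2(4) by (intro mult_mono) auto
      \<comment> \<open>The exponents satisfy
        \<open>(k + 3)\<^sup>2 + k * (k + 2) = 2 * (k + 2)\<^sup>2 + 1\<close>; the one spare factor
        \<open>\<epsilon>\<close> absorbs the constant \<open>n * (B + n)\<close>.\<close>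
      also have "\<dots> = n * (B + n) * \<epsilon> * (\<epsilon> ^ (Suc (Suc k))\<^sup>2 * \<epsilon> ^ (Suc (Suc k))\<^sup>2)"
      proof -
        have "(Suc (Suc (Suc k)))\<^sup>2 + k * (k + 2) = Suc ((Suc (Suc k))\<^sup>2 + (Suc (Suc k))\<^sup>2)"
          by (simp add: power2_eq_square)
        then have "\<epsilon> ^ (Suc (Suc (Suc k)))\<^sup>2 * \<epsilon> ^ (k * (k + 2))
            = \<epsilon> * (\<epsilon> ^ (Suc (Suc k))\<^sup>2 * \<epsilon> ^ (Suc (Suc k))\<^sup>2)"
          by (metis power_Suc power_add)
        then show ?thesis by (simp only: ac_simps)
      qed
      also have "\<dots> \<le> 1 * (\<epsilon> ^ (Suc (Suc k))\<^sup>2 * \<epsilon> ^ (Suc (Suc k))\<^sup>2)"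
        using \<epsilon> by (intro mult_right_mono) auto
      also have "\<dots> = w {v, ?u} * w {v, ?u}"
        using w_tree[OF v 2(2)] 2(4) by simp
      finally show ?thesis .
    qed
  qed
  have tree: "0 \<le> kappa_LLY G w (parent v) v" "0 \<le> kappa_LLY G w v (parent v)"
    if v: "v \<in> verts G" "v \<notin> K" for v
  proof -
    obtain T where T: "v \<in> T" "parent v \<notin> T"
      and cut: "\<And>a b. adj G a b \<Longrightarrow> a \<in> T \<Longrightarrow> b \<notin> T \<Longrightarrow> a = v \<and> b = parent v"
      using tree_edge_cut[OF v] by blast
    have "adj G (parent v) v" using parent(1)[OF v] by (simp add: adj_sym)
    from kappa_LLY_bridge_nonneg[OF simple fin pos this T cut ratio[OF v]]
    show "0 \<le> kappa_LLY G w (parent v) v" "0 \<le> kappa_LLY G w v (parent v)" by auto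
  qed
  have "0 \<le> kappa_LLY G w x y" if "adj G x y" for x y
    using that
  proof (cases rule: adj_cases)
    case core
    then have "adj P (Inl x) (Inl y)" by (simp add: adj_pendant_core)
    with assms have "0 \<le> kappa_LLY P w' (Inl x) (Inl y)" by (simp add: admissible_def)
    then show ?thesis using kappa_LLY_collapse[OF m pos pos' core(3)] by simp
  next
    case child
    then show ?thesis using tree(2)[of x] adjD[OF simple that] by simp
  next
    case parent
    then show ?thesis using tree(1)[of y] adjD[OF simple that] by simp
  qed
  with pos show ?thesis by (auto simp: admissible_def)
qed

end

theorem theorem1p2:
  fixes G :: "'a ugraph"
  assumes "simple_graph G"
    and "finite (verts G)"
    and "connected_graph G"
    and "verts (core2 G) \<noteq> {}"
  shows "DN_LLY G < \<infinity> \<longleftrightarrow> DN_LLY (pendant_core G) < \<infinity>"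
proof -
  interpret core_graph G by unfold_locales (fact assms)+
  show ?thesis
    unfolding DN_LLY_iff DN_LLY_pendant_core_iff
    using admissible_pendant_core admissible_if_pendant_core by blast
qed

end
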